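(* Consider the linear regression model $\boldsymbol{Y}=\boldsymbol{X}\boldsymbol{\beta}+\boldsymbol{\varepsilon}$, where $\boldsymbol{X}$ is a known $n\times p$ matrix with linearly independent columns ($n>p$) and $\boldsymbol{\varepsilon}\sim N(\boldsymbol{0},\sigma^2\boldsymbol{I}_n)$, $\sigma^2>0$ unknown. Let $\theta=\boldsymbol{a}^T\boldsymbol{\beta}$ ($\boldsymbol{a}\neq\boldsymbol{0}$ given), $\boldsymbol{\tau}=\boldsymbol{C}^T\boldsymbol{\beta}-\boldsymbol{t}$ with $\boldsymbol{C}$ a given $p\times s$ matrix ($s<p$) of linearly independent columns, $\boldsymbol{t}$ a given $s$-vector, and $\boldsymbol{a}$ not in the column span of $\boldsymbol{C}$. Let $\hat{\boldsymbol{\beta}}$ be the least squares estimator, $\hat\Sigma^2=\|\boldsymbol{Y}-\boldsymbol{X}\hat{\boldsymbol{\beta}}\|^2/(n-p)$, $\hat\Theta=\boldsymbol{a}^T\hat{\boldsymbol{\beta}}$, $\hat{\boldsymbol{\tau}}=\boldsymbol{C}^T\hat{\boldsymbol{\beta}}-\boldsymbol{t}$, and assume $E\big((\hat{\boldsymbol{\tau}}-\boldsymbol{\tau})(\hat\Theta-\theta)\big)=\boldsymbol{0}$. Let $m=n-p$, $v_{11}=\boldsymbol{a}^T(\boldsymbol{X}^T\boldsymbol{X})^{-1}\boldsymbol{a}$, $\boldsymbol{V}_{22}=\boldsymbol{C}^T(\boldsymbol{X}^T\boldsymbol{X})^{-1}\boldsymbol{C}$, $t(m)$ such that $P(-t(m)\le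 T\le t(m))=1-\alpha$ for $T\sim t_m$, and $F=\big(\hat{\boldsymbol{\tau}}^T\boldsymbol{V}_{22}^{-1}\hat{\boldsymbol{\tau}}/s\big)/\hat\Sigma^2$. For a continuous function $d:[0,\infty)\to(0,\infty)$ with $d(x)=t(m)$ for all $x\ge k$ ($k>0$ specified), let $J(d)=[\hat\Theta-\sqrt{v_{11}}\hat\Sigma d(\sqrt F),\ \hat\Theta+\sqrt{v_{11}}\hat\Sigma d(\sqrt F)]$ and $I=[\hat\Theta-t(m)\sqrt{v_{11}}\hat\Sigma,\ \hat\Theta+t(m)\sqrt{v_{11}}\hat\Sigma]$. Let $e(0;d)$ denote the scaled expected length $E(\text{length of }J(d))/E(\text{length of }I)$ evaluated at $\boldsymbol{\tau}=\boldsymbol{0}$, and let $W=\hat\Sigma/\sigma$ (which has the distribution of $\sqrt{\chi^2_m/m}$). Then $$e(0;d)=1+\frac{2^{3/2}\,s^{s/2}\,\Gamma((s+m+1)/2)}{t(m)\,E(W)\,\Gamma(m/2)\,\Gamma(s/2)}\int_0^k\big(d(x)-t(m)\big)\,x^{s-1}\,\frac{m^{m/2}}{(sx^2+m)^{(s+m+1)/2}}\,dx,$$ where $\Gamma$ is the gamma function.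
   Context: $0<\alpha<1$. *)

theory Defs
  imports "HOL-Analysis.Analysis" "HOL-Probability.Probability"
begin

definition lse :: "real^'p^'n \<Rightarrow> real^'n \<Rightarrow> real^'p" where
  "lse X y = matrix_inv (transpose X ** X) *v (transpose X *v y)"

definition sigma_hat_sq :: "real^'p^'n \<Rightarrow> real^'n \<Rightarrow> real" where
  "sigma_hat_sq X y = (norm (y - X *v lse X y))\<^sup>2 / (real CARD('n) - real CARD('p))"

definition t_density :: "nat \<Rightarrow> real \<Rightarrow> real" where
  "t_density m x = Gamma ((real m + 1) / 2) / (sqrt (real m * pi) * Gamma (real m / 2))
     * (1 + x\<^sup>2 / real m) powr (- (real m + 1) / 2)"

end

theory Submission
  imports Defs
begin

text \<open>
  When \<open>\<tau> = 0\<close>, both the numerator of \<open>F\<close> and \<open>\<Sigma>hat\<close> are functions of the error vector alone: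
  they are squared norms of its images under two orthogonal projections, of rank \<open>s\<close> and \<open>m\<close>, onto
  perpendicular subspaces. By rotation invariance of the standard normal law, the two norms, divided
  by \<open>\<sigma>\<close>, are independent chi variables \<open>R\<close> and \<open>U\<close>, and
  \<open>W = U / sqrt m\<close>, \<open>sqrt F = sqrt (m / s) * R / U\<close>.
  Substituting \<open>x = sqrt F\<close> for \<open>R\<close> and integrating out \<open>U\<close>, which leaves a Gaussian moment, shows
  that the law of \<open>sqrt F\<close> under the measure with density \<open>W\<close> has the density occurring in
  the formula; the claim follows by integrating \<open>d - tm\<close>, which vanishes beyond \<open>k\<close>.
\<close>

section \<open>The chi distribution\<close>

text \<open>The length of J(d) multiplies \<open>\<Sigma>hat\<close> by a function of
  \<open>F\<close>, and \<open>F\<close> contains \<open>\<Sigma>hat\<close> again, so the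
  expectation does not factor. Moving the factor \<open>W\<close> into the measure leaves a
  one-dimensional law, that of sqrt F. Its total mass is E(W) instead of 1: the constant
  \<open>tm\<close> contributes tm E(W), which is the expected length of I up to the common factor
  and becomes the leading 1 of the formula. The weight is also what raises the exponent from the
  (s+m)/2 of an unweighted ratio to (s+m+1)/2. The law is identified with nonnegative integrals,
  where substitution and interchange of integrals need no integrability; finiteness matters only
  once the signed function d - tm is integrated. Rotation invariance of the normal law is reduced to
  that of Lebesgue measure, which comes from uniqueness of the translation-invariant measure and not
  from a determinant.\<close>

definition chi_density :: "nat \<Rightarrow> real \<Rightarrow> real" where
  "chi_density N r = indicator {0..} r * r ^ (N - 1) * exp (- r\<^sup>2 / 2)
     / (2 powr (real N / 2 - 1) * Gamma (real N / 2))"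

lemma chi_density_nonneg: "0 \<le> chi_density N r"
proof (cases "N = 0")
  \<comment> \<open>Default values: Gamma is 0 at its pole 0, and division by 0 gives 0.\<close>
  case True
  then show ?thesis by (simp add: chi_density_def)
next
  case False
  then have "Gamma (real N / 2) > 0" by (intro Gamma_real_pos) simp
  then show ?thesis by (auto simp: chi_density_def indicator_def)
qed

lemma borel_measurable_chi_density [measurable]: "chi_density N \<in> borel_measurable borel"
  unfolding chi_density_def by measurable

text \<open>A product measure is determined by its values on boxes, and there the indicator factors
  along with the density, so the integral splits into one factor per coordinate.\<close>

lemma PiM_density:
  assumes "product_sigma_finite M" "product_sigma_finite (\<lambda>i. density (M i) (f i))" "finite I"
    and [measurable]: "\<And>i. f i \<in> borel_measurable (M i)"
  shows "Pi\<^sub>M I (\<lambda>i. density (M i) (f i)) = density (Pi\<^sub>M I M) (\<lambda>x. \<Prod>i\<in>I. f i (x i))"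
proof -
  interpret product_sigma_finite M by fact
  interpret D: product_sigma_finite "\<lambda>i. density (M i) (f i)" by fact
  have [simp]: "sets (Pi\<^sub>M I (\<lambda>i. density (M i) (f i))) = sets (Pi\<^sub>M I M)"
    by (rule sets_PiM_cong) auto
  show ?thesis
  proof (rule D.PiM_eqI[symmetric])
    fix A assume "\<And>i. i \<in> I \<Longrightarrow> A i \<in> sets (density (M i) (f i))"
    then have A: "A i \<in> sets (M i)" if "i \<in> I" for i using that by simp
    have "emeasure (density (Pi\<^sub>M I M) (\<lambda>x. \<Prod>i\<in>I. f i (x i))) (Pi\<^sub>E I A)
        = (\<integral>\<^sup>+x. (\<Prod>i\<in>I. f i (x i)) * indicator (Pi\<^sub>E I A) x \<partial>Pi\<^sub>M I M)"
      using A assms(3) by (subst emeasure_density) (auto intro!: sets_PiM_I_finite)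
    also have "\<dots> = (\<integral>\<^sup>+x. (\<Prod>i\<in>I. f i (x i) * indicator (A i) (x i)) \<partial>Pi\<^sub>M I M)"
    proof (rule nn_integral_cong)
      fix x assume "x \<in> space (Pi\<^sub>M I M)"
      then have "indicator (Pi\<^sub>E I A) x = (\<Prod>i\<in>I. indicator (A i) (x i) :: ennreal)"
        using assms(3) by (cases "\<forall>i\<in>I. x i \<in> A i")
          (auto simp: space_PiM PiE_def Pi_def indicator_def prod_zero_iff)
      then show "(\<Prod>i\<in>I. f i (x i)) * indicator (Pi\<^sub>E I A) x = (\<Prod>i\<in>I. f i (x i) * indicator (A i) (x i))"
        by (simp add: prod.distrib)
    qed
    also have "\<dots> = (\<Prod>i\<in>I. emeasure (density (M i) (f i)) (A i))"
      using A assms(3) by (subst product_nn_integral_prod) (auto simp: emeasure_density intro!: prod.cong)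
    finally show "emeasure (density (Pi\<^sub>M I M) (\<lambda>x. \<Prod>i\<in>I. f i (x i))) (Pi\<^sub>E I A)
        = (\<Prod>i\<in>I. emeasure (density (M i) (f i)) (A i))" .
  qed (use assms in auto)
qed

text \<open>The joint density sees a point only through its sum of squares. Both the law of the norm
  and rotation invariance are read off from this form.\<close>

lemma PiM_std_normal:
  assumes "finite I"
  shows "Pi\<^sub>M I (\<lambda>_. density lborel std_normal_density)
    = density (Pi\<^sub>M I (\<lambda>_. lborel)) (\<lambda>x. ennreal ((2 * pi) powr (- real (card I) / 2) * exp (- (\<Sum>i\<in>I. (x i)\<^sup>2) / 2)))"
proof -
  interpret prob_space "density lborel (\<lambda>x. ennreal (std_normal_density x))"
    by (rule prob_space_normal_density) simp
  have "Pi\<^sub>M I (\<lambda>_. density lborel std_normal_density)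
     = density (Pi\<^sub>M I (\<lambda>_. lborel)) (\<lambda>x. \<Prod>i\<in>I. ennreal (std_normal_density (x i)))"
    using assms by (intro PiM_density)
      (auto intro!: product_sigma_finite.intro lborel.sigma_finite_measure_axioms sigma_finite_measure_axioms)
  also have "(\<lambda>x. \<Prod>i\<in>I. ennreal (std_normal_density (x i)))
     = (\<lambda>x. ennreal ((2 * pi) powr (- real (card I) / 2) * exp (- (\<Sum>i\<in>I. (x i)\<^sup>2) / 2)))"
  proof
    fix x
    have c: "1 / sqrt (2 * pi) = (2 * pi) powr (- 1 / 2)"
      by (simp add: powr_minus_divide powr_half_sqrt)
    have "(\<Prod>i\<in>I. std_normal_density (x i)) = (1 / sqrt (2 * pi)) ^ card I * (\<Prod>i\<in>I. exp (- (x i)\<^sup>2 / 2))"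
      by (simp only: std_normal_density_def prod.distrib prod_constant)
    also have "(1 / sqrt (2 * pi)) ^ card I = (2 * pi) powr (- real (card I) / 2)"
      unfolding c by (simp add: powr_power)
    also have "(\<Prod>i\<in>I. exp (- (x i)\<^sup>2 / 2)) = exp (- (\<Sum>i\<in>I. (x i)\<^sup>2) / 2)"
      using assms by (simp add: exp_sum[symmetric] sum_negf sum_divide_distrib)
    finally show "(\<Prod>i\<in>I. ennreal (std_normal_density (x i)))
      = ennreal ((2 * pi) powr (- real (card I) / 2) * exp (- (\<Sum>i\<in>I. (x i)\<^sup>2) / 2))"
      by (simp add: prod_ennreal)
  qed
  finally show ?thesis .
qed

text \<open>Polar coordinates for radial functions: the ball of radius a has volume proportional to
  a^N, and the density on the right is its derivative. Agreement on the half-lines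
  \<open>{..a}\<close>, which generate the Borel sets and are closed under intersection,
  suffices.\<close>

lemma distr_norm_lborel:
  assumes "finite I" "I \<noteq> {}"
  shows "distr (Pi\<^sub>M I (\<lambda>_. lborel)) borel (\<lambda>x. sqrt (\<Sum>i\<in>I. (x i)\<^sup>2))
    = density lborel (\<lambda>r. ennreal (indicator {0..} r * (real (card I) * unit_ball_vol (card I) * r ^ (card I - 1))))"
    (is "?L = ?R")
proof -
  let ?N = "card I"
  have N: "?N > 0" using assms by (simp add: card_gt_0_iff)
  have meas[measurable]: "(\<lambda>x. sqrt (\<Sum>i\<in>I. (x i)\<^sup>2)) \<in> borel_measurable (Pi\<^sub>M I (\<lambda>_. lborel))"
    using assms by measurable
  have L: "emeasure ?L {..a} = (if a \<le> 0 then 0 else ennreal (unit_ball_vol ?N * a ^ ?N))" for a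
  proof -
    have *: "emeasure ?L {..a} = ennreal (unit_ball_vol ?N * a ^ ?N)" if "a > 0" for a
    proof -
      have "emeasure ?L {..a} = emeasure (Pi\<^sub>M I (\<lambda>_. lborel))
         ({f. sqrt (\<Sum>i\<in>I. (f i)\<^sup>2) \<le> a} \<inter> space (Pi\<^sub>M I (\<lambda>_. lborel)))"
        by (subst emeasure_distr) (auto intro!: arg_cong2[where f=emeasure])
      then show ?thesis using emeasure_cball_aux[OF assms(1) that] by simp
    qed
    show ?thesis
    proof (cases "a > 0")
      case True
      then show ?thesis using * by simp
    next
      case False
      \<comment> \<open>For nonpositive a the set lies in every ball around 0; \<open>b\<close> is
        the radius at which the ball has volume exactly e, and e is arbitrary.\<close>
      have small: "emeasure ?L {..a} \<le> ennreal e" if "e > 0" for e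
      proof -
        define b where "b = root ?N (e / unit_ball_vol ?N)"
        have v: "unit_ball_vol ?N > 0" by simp
        have "b > 0" unfolding b_def using that v N by (intro real_root_gt_zero) auto
        then have "emeasure ?L {..a} \<le> emeasure ?L {..b}"
          using False by (intro emeasure_mono) auto
        also have "\<dots> = ennreal (unit_ball_vol ?N * b ^ ?N)" using * \<open>b > 0\<close> by simp
        also have "unit_ball_vol ?N * b ^ ?N = e"
        proof -
          have "b ^ ?N = e / unit_ball_vol ?N"
            unfolding b_def using that v N by (intro real_root_pow_pos2 divide_nonneg_pos) auto
          then show ?thesis using less_imp_neq[OF v, symmetric] by (metis nonzero_mult_div_cancel_left times_divide_eq_right)
        qed
        finally show ?thesis .
      qed
      have "emeasure ?L {..a} \<le> 0"
      proof (rule ennreal_le_epsilon)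
        show "emeasure ?L {..a} \<le> 0 + ennreal e" if "e > 0" for e
          using small[OF that] by (simp only: add_0)
      qed
      then have "emeasure ?L {..a} = 0" by (simp only: le_zero_eq)
      with False show ?thesis by (simp only: if_True not_less)
    qed
  qed
  have R: "emeasure ?R {..a} = (if a \<le> 0 then 0 else ennreal (unit_ball_vol ?N * a ^ ?N))" for a
  proof -
    have "emeasure ?R {..a} = (\<integral>\<^sup>+ r. ennreal (real ?N * unit_ball_vol ?N * r ^ (?N - 1)) * indicator {0..a} r \<partial>lborel)"
      by (subst emeasure_density) (auto intro!: nn_integral_cong split: split_indicator)
    also have "\<dots> = (if a \<le> 0 then 0 else ennreal (unit_ball_vol ?N * a ^ ?N))"
    proof (cases "a \<ge> 0")
      case True
      have "(\<integral>\<^sup>+ r. ennreal (real ?N * unit_ball_vol ?N * r ^ (?N - 1)) * indicator {0..a} r \<partial>lborel)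
         = ennreal (unit_ball_vol ?N * a ^ ?N - unit_ball_vol ?N * 0 ^ ?N)"
        using True by (subst nn_integral_FTC_Icc[where F = "\<lambda>r. unit_ball_vol ?N * r ^ ?N"])
          (auto intro!: derivative_eq_intros)
      then show ?thesis using True N by (auto simp: zero_power)
    qed auto
    finally show ?thesis .
  qed
  show ?thesis
  \<comment> \<open>The total mass is infinite, so the comparison on the generator needs the
    exhaustion by the finite-measure sets \<open>{..real i}\<close>.\<close>
  proof (rule measure_eqI_generator_eq[where E = "range atMost" and \<Omega> = UNIV and A = "\<lambda>i. {..real i}"])
    show "Int_stable (range atMost :: real set set)" by (auto simp: Int_stable_def)
    show "(\<Union>i. {..real i}) = UNIV" by (auto intro: real_arch_simple)
    show "emeasure ?L {..real i} \<noteq> \<infinity>" for i unfolding L by simp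
    show "sets ?L = sigma_sets UNIV (range atMost)" "sets ?R = sigma_sets UNIV (range atMost)"
      by (simp_all add: borel_eq_atMost)
  qed (use L R in auto)
qed

text \<open>The Gaussian density is a function \<open>?g\<close> of the norm, so it passes through
  the push-forward along the norm and multiplies the radial density of Lebesgue measure.\<close>

lemma distr_norm_std_normal:
  assumes "finite I" "I \<noteq> {}"
  shows "distr (Pi\<^sub>M I (\<lambda>_. density lborel std_normal_density)) borel (\<lambda>x. sqrt (\<Sum>i\<in>I. (x i)\<^sup>2))
    = density lborel (chi_density (card I))"
proof -
  let ?N = "card I"
  let ?T = "\<lambda>x. sqrt (\<Sum>i\<in>I. (x i)\<^sup>2) :: real"
  let ?g = "\<lambda>r. ennreal ((2 * pi) powr (- real (card I) / 2) * exp (- r\<^sup>2 / 2))"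
  have N: "?N > 0" using assms by (simp add: card_gt_0_iff)
  have G: "Gamma (real ?N / 2) > 0" using N by (intro Gamma_real_pos) simp
  have meas[measurable]: "?T \<in> borel_measurable (Pi\<^sub>M I (\<lambda>_. lborel))"
    using assms by measurable
  have "distr (Pi\<^sub>M I (\<lambda>_. density lborel std_normal_density)) borel ?T
     = distr (density (Pi\<^sub>M I (\<lambda>_. lborel)) (\<lambda>x. ?g (?T x))) borel ?T"
    by (subst PiM_std_normal[OF assms(1)]) (simp add: sum_nonneg)
  also have "\<dots> = density (distr (Pi\<^sub>M I (\<lambda>_. lborel)) borel ?T) ?g"
    by (subst density_distr) auto
  also have "\<dots> = density lborel (\<lambda>r. ennreal (indicator {0..} r * (real (card I) * unit_ball_vol (card I) * r ^ (card I - 1))) * ?g r)"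
    unfolding distr_norm_lborel[OF assms] by (subst density_density_eq) auto
  also have "\<dots> = density lborel (chi_density ?N)"
  proof (rule density_cong)
    \<comment> \<open>The ball volume is pi^(N/2) / Gamma(N/2 + 1); the powers of pi cancel, and the
      functional equation of Gamma removes the factor N.\<close>
    have c: "real ?N * unit_ball_vol ?N * (2 * pi) powr (- real ?N / 2) = 1 / (2 powr (real ?N / 2 - 1) * Gamma (real ?N / 2))"
    proof -
      have "Gamma (real ?N / 2 + 1) = real ?N / 2 * Gamma (real ?N / 2)"
        using N by (subst Gamma_plus1) (auto simp: nonpos_Ints_def)
      then show ?thesis
        using N G by (simp only: unit_ball_vol_def powr_mult powr_minus powr_diff minus_divide_left[symmetric]) (simp add: field_simps)
    qed
    show "AE r in lborel. ennreal (indicator {0..} r * (real ?N * unit_ball_vol ?N * r ^ (?N - 1))) * ?g r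
        = ennreal (chi_density ?N r)"
    proof (rule AE_I2)
      fix r :: real
      have "indicator {0..} r * (real ?N * unit_ball_vol ?N * r ^ (?N - 1)) * ((2 * pi) powr (- real ?N / 2) * exp (- r\<^sup>2 / 2))
        = chi_density ?N r"
        using arg_cong[OF c, of "\<lambda>c. indicator {0..} r * c * r ^ (?N - 1) * exp (- r\<^sup>2 / 2)"]
        by (simp add: chi_density_def algebra_simps)
      moreover have "0 \<le> indicator {0..} r * (real ?N * unit_ball_vol ?N * r ^ (?N - 1))"
        by (auto simp: indicator_def)
      ultimately show "ennreal (indicator {0..} r * (real ?N * unit_ball_vol ?N * r ^ (?N - 1))) * ?g r
        = ennreal (chi_density ?N r)"
        by (simp add: ennreal_mult''[symmetric])
    qed
  qed auto
  finally show ?thesis .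
qed

text \<open>The normalisation comes without a gamma integral: the density belongs to an image of a
  probability measure.\<close>

lemma nn_integral_chi_density:
  assumes "N > 0"
  shows "(\<integral>\<^sup>+r. chi_density N r \<partial>lborel) = 1"
proof -
  have I: "finite {..<N}" "{..<N} \<noteq> {}" using assms by auto
  interpret N: prob_space "density lborel (\<lambda>x. ennreal (std_normal_density x))"
    by (rule prob_space_normal_density) simp
  interpret prob_space "Pi\<^sub>M {..<N} (\<lambda>_. density lborel (\<lambda>x. ennreal (std_normal_density x)))"
    by (intro prob_space_PiM N.prob_space_axioms)
  have "prob_space (density lborel (chi_density N))"
    using distr_norm_std_normal[OF I] prob_space_distr[of "\<lambda>x. sqrt (\<Sum>i<N. (x i)\<^sup>2)" borel] by simp
  from prob_space.emeasure_space_1[OF this] show ?thesis by (simp add: emeasure_density)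
qed

text \<open>This is the total mass of the chi law after rescaling its argument by sqrt c. It serves
  for the integral over the residual norm, with c depending on the ratio, and for the mean of a chi
  variable, with c = 1.\<close>

lemma nn_integral_power_gaussian:
  assumes "N > 0" "c > 0"
  shows "(\<integral>\<^sup>+u. ennreal (indicator {0..} u * u ^ (N - 1) * exp (- c * u\<^sup>2 / 2)) \<partial>lborel)
    = ennreal (2 powr (real N / 2 - 1) * Gamma (real N / 2) / c powr (real N / 2))"
proof -
  define D where "D = 2 powr (real N / 2 - 1) * Gamma (real N / 2)"
  have "Gamma (real N / 2) > 0" using assms by (intro Gamma_real_pos) simp
  then have D: "D > 0" by (simp add: D_def)
  let ?f = "\<lambda>u. indicator {0..} u * u ^ (N - 1) * exp (- c * u\<^sup>2 / 2) :: real"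
  have chi: "chi_density N (0 + sqrt c * u) = sqrt c ^ (N - 1) / D * ?f u" for u
    using assms(2) by (simp add: chi_density_def D_def power_mult_distrib indicator_def zero_le_mult_iff)
  have "1 = ennreal (sqrt c) * (\<integral>\<^sup>+u. ennreal (chi_density N (0 + sqrt c * u)) \<partial>lborel)"
    using assms by (subst nn_integral_chi_density[OF assms(1), symmetric], subst nn_integral_real_affine[of _ "sqrt c" 0]) auto
  also have "(\<integral>\<^sup>+u. ennreal (chi_density N (0 + sqrt c * u)) \<partial>lborel)
     = ennreal (sqrt c ^ (N - 1) / D) * (\<integral>\<^sup>+u. ennreal (?f u) \<partial>lborel)"
    unfolding chi using D assms by (subst nn_integral_cmult[symmetric]) (auto simp: ennreal_mult'[symmetric])
  also have "ennreal (sqrt c) * (ennreal (sqrt c ^ (N - 1) / D) * (\<integral>\<^sup>+u. ennreal (?f u) \<partial>lborel))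
     = ennreal (c powr (real N / 2) / D) * (\<integral>\<^sup>+u. ennreal (?f u) \<partial>lborel)"
  proof -
    have "sqrt c * sqrt c ^ (N - 1) = sqrt c ^ N" using assms by (simp add: power_eq_if)
    also have "\<dots> = c powr (real N / 2)" using assms by (simp add: powr_half_sqrt[symmetric] powr_power)
    finally have "sqrt c * (sqrt c ^ (N - 1) / D) = c powr (real N / 2) / D" by simp
    then show ?thesis using assms D by (simp add: mult.assoc[symmetric] ennreal_mult'[symmetric])
  qed
  finally have "ennreal (D / c powr (real N / 2)) * 1
    = ennreal (D / c powr (real N / 2)) * (ennreal (c powr (real N / 2) / D) * (\<integral>\<^sup>+u. ennreal (?f u) \<partial>lborel))"
    by simp
  also have "\<dots> = (\<integral>\<^sup>+u. ennreal (?f u) \<partial>lborel)"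
    using D assms by (simp add: mult.assoc[symmetric] ennreal_mult'[symmetric])
  finally show ?thesis by (simp add: D_def)
qed

section \<open>Rotation invariance of the standard normal law\<close>

text \<open>Independence is expressed by product measures on functions, rotations act on the
  Euclidean vector type; this identifies the two Lebesgue measures by their values on boxes.\<close>

lemma distr_lborel_vec_lambda:
  "distr (Pi\<^sub>M UNIV (\<lambda>_::'n::finite. lborel)) borel (\<lambda>f. \<chi> i. f i) = (lborel :: (real^'n) measure)"
proof (rule lborel_eqI[symmetric])
  interpret product_sigma_finite "\<lambda>_::'n. lborel :: real measure" ..
  have [measurable]: "(\<lambda>f. \<chi> i. f i :: real^'n) \<in> borel_measurable (Pi\<^sub>M UNIV (\<lambda>_. lborel))"
    by (rule borel_measurable_euclidean_space[THEN iffD2]) (auto simp: Basis_vec_def inner_axis)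
  fix l u :: "real^'n" assume le: "\<And>b. b \<in> Basis \<Longrightarrow> l \<bullet> b \<le> u \<bullet> b"
  have *: "l $ i \<le> u $ i" for i
    using le[of "axis i 1"] by (auto simp: inner_axis axis_in_Basis_iff)
  have "emeasure (distr (Pi\<^sub>M UNIV (\<lambda>_::'n. lborel)) borel (\<lambda>f. \<chi> i. f i)) (box l u)
     = emeasure (Pi\<^sub>M UNIV (\<lambda>_::'n. lborel)) (Pi\<^sub>E UNIV (\<lambda>i. {l$i<..<u$i}))"
    by (subst emeasure_distr)
      (auto simp: space_PiM mem_box_cart PiE_def Pi_def intro!: arg_cong2[where f=emeasure])
  also have "\<dots> = (\<Prod>i\<in>UNIV. ennreal (u$i - l$i))"
    by (subst emeasure_PiM) (auto simp: *)
  also have "\<dots> = ennreal (\<Prod>i\<in>UNIV. (u - l)$i)"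
    using * by (subst prod_ennreal) (auto simp: )
  also have "(\<Prod>i\<in>UNIV. (u - l)$i) = (\<Prod>b\<in>Basis. (u - l) \<bullet> b)"
  proof -
    have B: "Basis = range (\<lambda>i. axis i (1::real) :: real^'n)" by (auto simp: Basis_vec_def)
    have inj: "inj (\<lambda>i. axis i (1::real) :: real^'n)" by (simp add: inj_on_def axis_eq_axis)
    show ?thesis unfolding B prod.reindex[OF inj] by (simp add: inner_axis)
  qed
  finally show "emeasure (distr (Pi\<^sub>M UNIV (\<lambda>_::'n. lborel)) borel (\<lambda>f. \<chi> i. f i)) (box l u)
    = ennreal (\<Prod>b\<in>Basis. (u - l) \<bullet> b)" .
qed simp

text \<open>Computing \<open>\<integral>\<integral> 1\<^bsub>A\<^esub>(x) 1\<^bsub>B\<^esub>(y + x)\<close> in the two possible orders gives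
  \<open>\<mu>(A) \<lambda>(B) = \<mu>(B) \<lambda>(A)\<close>.\<close>

lemma translation_invariant_eq_lborel:
  fixes M :: "'a::euclidean_space measure"
  assumes setsM[measurable_cong]: "sets M = sets borel" and "sigma_finite_measure M"
    and inv: "\<And>c. distr M borel ((+) c) = M"
    and B: "B \<in> sets borel" "emeasure M B = emeasure lborel B" "emeasure lborel B \<noteq> 0" "emeasure lborel B \<noteq> \<infinity>"
  shows "M = lborel"
proof (rule measure_eqI)
  fix A assume "A \<in> sets M"
  then have A[measurable]: "A \<in> sets borel" by (simp only: setsM)
  note B(1)[measurable]
  interpret M: sigma_finite_measure M by fact
  interpret pair_sigma_finite M lborel ..
  have trans: "(\<integral>\<^sup>+x. f x \<partial>N) = (\<integral>\<^sup>+x. f (c + x) \<partial>N)"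
    if "distr N borel ((+) c) = N" and [measurable]: "f \<in> borel_measurable borel" "sets N = sets borel"
    for f :: "'a \<Rightarrow> ennreal" and N c
  proof -
    have [measurable]: "(+) c \<in> N \<rightarrow>\<^sub>M borel" by (subst measurable_cong_sets[OF that(3) refl]) simp
    show ?thesis by (subst that(1)[symmetric], subst nn_integral_distr) auto
  qed
  have refl: "(\<integral>\<^sup>+y. indicator A (x - y) \<partial>lborel) = emeasure lborel A" for x :: 'a
  proof -
    have "emeasure lborel A = (\<integral>\<^sup>+y. indicator A y \<partial>lborel)" by simp
    also have "\<dots> = (\<integral>\<^sup>+y. indicator A (x + (- 1) *\<^sub>R y) \<partial>lborel)"
      by (subst lborel_affine[of "- 1" x])
        (simp_all add: nn_integral_density nn_integral_distr del: nn_integral_indicator)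
    finally show ?thesis by simp
  qed
  have "emeasure M A * emeasure lborel B = (\<integral>\<^sup>+x. indicator A x * emeasure lborel B \<partial>M)"
    by (simp add: nn_integral_multc setsM)
  also have "\<dots> = (\<integral>\<^sup>+x. \<integral>\<^sup>+y. indicator A x * indicator B (x + y) \<partial>lborel \<partial>M)"
  proof (rule nn_integral_cong)
    fix x
    have "emeasure lborel B = (\<integral>\<^sup>+y. indicator B y \<partial>lborel)" by simp
    also have "\<dots> = (\<integral>\<^sup>+y. indicator B (x + y) \<partial>lborel)"
      by (rule trans[OF lborel_distr_plus]) auto
    finally show "indicator A x * emeasure lborel B = (\<integral>\<^sup>+y. indicator A x * indicator B (x + y) \<partial>lborel)"
      by (simp add: nn_integral_cmult)
  qed
  also have "\<dots> = (\<integral>\<^sup>+y. \<integral>\<^sup>+x. indicator A x * indicator B (x + y) \<partial>M \<partial>lborel)"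
    by (rule Fubini'[symmetric]) auto
  \<comment> \<open>With y fixed, invariance of \<open>M\<close> under the shift by -y moves the
    translate from B to A, so that the integral over y can next be taken by reflection.\<close>
  also have "\<dots> = (\<integral>\<^sup>+y. \<integral>\<^sup>+x. indicator A (x - y) * indicator B x \<partial>M \<partial>lborel)"
  proof (rule nn_integral_cong)
    fix y
    show "(\<integral>\<^sup>+x. indicator A x * indicator B (x + y) \<partial>M) = (\<integral>\<^sup>+x. indicator A (x - y) * indicator B x \<partial>M)"
      using trans[OF inv, of "\<lambda>x. indicator A x * indicator B (x + y)" "- y"] by (simp add: setsM)
  qed
  also have "\<dots> = (\<integral>\<^sup>+x. \<integral>\<^sup>+y. indicator A (x - y) * indicator B x \<partial>lborel \<partial>M)"
    by (rule Fubini') auto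
  also have "\<dots> = emeasure lborel A * emeasure M B"
    by (simp add: nn_integral_multc nn_integral_cmult refl setsM)
  finally have "emeasure M A * emeasure lborel B = emeasure lborel A * emeasure lborel B"
    using B by simp
  then show "emeasure M A = emeasure lborel A"
    using B by (simp add: mult.commute[of _ "emeasure lborel B"] ennreal_mult_cancel_left)
qed (simp only: setsM sets_lborel)

text \<open>Since f (g c + x) = c + f x for a right inverse g, the image measure is again
  translation invariant. The unit ball, which f preserves, fixes the scaling factor; balls of
  integer radius give sigma-finiteness.\<close>

lemma distr_lborel_orthogonal_transformation:
  fixes f :: "'a::euclidean_space \<Rightarrow> 'a"
  assumes f: "orthogonal_transformation f"
  shows "distr lborel borel f = lborel"
proof -
  have lin: "linear f" using f by (rule orthogonal_transformation_linear)
  then have [measurable]: "f \<in> borel_measurable borel"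
    by (intro borel_measurable_continuous_onI linear_continuous_on) (simp add: linear_linear)
  obtain g where g: "orthogonal_transformation g" "\<And>x. f (g x) = x"
    using f by (metis orthogonal_transformation_inv orthogonal_transformation_surj surj_f_inv_f)
  show ?thesis
  proof (rule translation_invariant_eq_lborel[where B = "cball 0 1"])
    show "distr (distr lborel borel f) borel ((+) c) = distr lborel borel f" for c
    proof -
      have "distr lborel borel f = distr (distr lborel borel ((+) (g c))) borel f"
        by (simp add: lborel_distr_plus)
      also have "\<dots> = distr lborel borel (\<lambda>x. c + f x)"
        by (subst distr_distr) (auto simp: comp_def linear_add[OF lin] g)
      also have "\<dots> = distr (distr lborel borel f) borel ((+) c)"
        by (subst distr_distr) (auto simp: comp_def)
      finally show ?thesis by simp
    qed
    show "emeasure (distr lborel borel f) (cball 0 1) = emeasure lborel (cball (0::'a) 1)"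
      using orthogonal_transformation_norm[OF f]
      by (subst emeasure_distr) (auto simp: cball_def dist_norm vimage_def)
    show "emeasure lborel (cball (0::'a) 1) \<noteq> 0"
      by (subst emeasure_cball) (auto simp: ennreal_eq_0_iff not_le)
    show "emeasure lborel (cball (0::'a) 1) \<noteq> \<infinity>"
      by (subst emeasure_cball) auto
    show "sigma_finite_measure (distr lborel borel f)"
    proof
      define A where "A = range (\<lambda>n::nat. cball (0::'a) (real n))"
      have "emeasure (distr lborel borel f) (cball 0 (real n)) \<noteq> \<infinity>" for n
      proof -
        have "f -` cball 0 (real n) = cball 0 (real n)"
          using orthogonal_transformation_norm[OF f] by (auto simp: cball_def dist_norm)
        then show ?thesis by (subst emeasure_distr) (auto simp: emeasure_cball)
      qed
      moreover have "\<Union>A = UNIV" unfolding A_def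
        by (auto simp: dist_norm intro: real_arch_simple)
      ultimately show "\<exists>A. countable A \<and> A \<subseteq> sets (distr lborel borel f) \<and> \<Union> A = space (distr lborel borel f) \<and>
          (\<forall>a\<in>A. emeasure (distr lborel borel f) a \<noteq> \<infinity>)"
        by (intro exI[of _ A]) (auto simp: A_def)
    qed
  qed auto
qed

text \<open>The law is carried from functions to vectors by \<open>v\<close>, rotated there, and
  carried back by \<open>($)\<close>. On vectors its density with respect to Lebesgue measure
  depends on the norm only, and f preserves both the norm and Lebesgue measure.\<close>

lemma orthogonal_image_std_normal:
  fixes f :: "real^'n \<Rightarrow> real^'n" and Z :: "'n \<Rightarrow> 'w \<Rightarrow> real"
  assumes f: "orthogonal_transformation f"
  assumes Z[measurable]: "\<And>i. Z i \<in> borel_measurable M"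
    and law: "distr M (Pi\<^sub>M UNIV (\<lambda>_. borel)) (\<lambda>\<omega> i. Z i \<omega>) = Pi\<^sub>M UNIV (\<lambda>_. density lborel std_normal_density)"
  shows "distr M (Pi\<^sub>M UNIV (\<lambda>_. borel)) (\<lambda>\<omega> i. f (\<chi> j. Z j \<omega>) $ i) = Pi\<^sub>M UNIV (\<lambda>_. density lborel std_normal_density)"
proof -
  let ?P = "Pi\<^sub>M UNIV (\<lambda>_::'n. borel :: real measure)"
  let ?g = "\<lambda>x::real^'n. ennreal ((2 * pi) powr (- real CARD('n) / 2) * exp (- (norm x)\<^sup>2 / 2))"
  define v :: "('n \<Rightarrow> real) \<Rightarrow> real^'n" where "v = (\<lambda>x. \<chi> i. x i)"
  have v1: "v \<in> borel_measurable (Pi\<^sub>M UNIV (\<lambda>_::'n. lborel))" and v2[measurable]: "v \<in> ?P \<rightarrow>\<^sub>M borel"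
    unfolding v_def
    by (rule borel_measurable_euclidean_space[THEN iffD2]; auto simp: Basis_vec_def inner_axis)+
  have w[measurable]: "($) \<in> borel \<rightarrow>\<^sub>M ?P"
    by (rule measurable_PiM_single') auto
  have lin: "linear f" using f by (rule orthogonal_transformation_linear)
  then have [measurable]: "f \<in> borel_measurable borel"
    by (intro borel_measurable_continuous_onI linear_continuous_on) (simp add: linear_linear)
  have ZP: "(\<lambda>\<omega> i. Z i \<omega>) \<in> M \<rightarrow>\<^sub>M ?P"
    by (rule measurable_PiM_single') auto
  have nth_v: "($) (v x) = x" for x by (simp add: v_def fun_eq_iff)
  have norm_v: "(\<Sum>i\<in>UNIV. (x i)\<^sup>2) = (norm (v x))\<^sup>2" for x
    by (simp add: v_def norm_vec_def L2_set_def sum_nonneg)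
  have std: "Pi\<^sub>M UNIV (\<lambda>_::'n. density lborel std_normal_density) = density (Pi\<^sub>M UNIV (\<lambda>_. lborel)) (\<lambda>x. ?g (v x))"
    by (subst PiM_std_normal) (simp_all add: norm_v)
  have *: "distr (density (Pi\<^sub>M UNIV (\<lambda>_::'n. lborel)) (\<lambda>x. ?g (v x))) borel v = density lborel ?g"
    using v1 by (subst density_distr[symmetric]) (simp_all add: v_def distr_lborel_vec_lambda)
  have "density lborel ?g = density (distr lborel borel f) ?g"
    by (simp add: distr_lborel_orthogonal_transformation[OF f])
  also have "\<dots> = distr (density lborel ?g) borel f"
    by (subst density_distr) (simp_all add: orthogonal_transformation_norm[OF f])
  finally have inv: "distr (density lborel ?g) borel f = density lborel ?g" by simp
  have "distr M ?P (\<lambda>\<omega> i. f (\<chi> j. Z j \<omega>) $ i) = distr (distr (distr (distr M ?P (\<lambda>\<omega> i. Z i \<omega>)) borel v) borel f) ?P ($)"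
    using ZP by (simp add: distr_distr comp_def v_def[symmetric])
  also have "\<dots> = distr (distr (distr (Pi\<^sub>M UNIV (\<lambda>_. density lborel std_normal_density)) borel v) borel f) ?P ($)"
    by (simp add: law)
  also have "\<dots> = distr (distr (Pi\<^sub>M UNIV (\<lambda>_. density lborel std_normal_density)) borel v) ?P ($)"
    unfolding std * inv ..
  also have "\<dots> = distr (Pi\<^sub>M UNIV (\<lambda>_. density lborel std_normal_density)) ?P (\<lambda>x. x)"
    using v1 w by (subst distr_distr) (auto simp: nth_v comp_def std cong: measurable_cong_sets)
  also have "\<dots> = Pi\<^sub>M UNIV (\<lambda>_. density lborel std_normal_density)"
    by (intro distr_id2) (auto intro!: sets_PiM_cong)
  finally show ?thesis .
qed

section \<open>Quadratic forms of the regression model\<close>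

text \<open>Parseval on the range of P: a symmetric idempotent map fixes each b in its range, so the
  coefficient of P x along b equals that of x.\<close>

lemma norm_projection_eq_sum:
  fixes P :: "'a::euclidean_space \<Rightarrow> 'a"
  assumes "\<And>x y. P x \<bullet> y = x \<bullet> P y" "\<And>x. P (P x) = P x"
    and B: "pairwise orthogonal B" "\<And>b. b \<in> B \<Longrightarrow> norm b = 1" "finite B" "span B = range P"
  shows "(norm (P x))\<^sup>2 = (\<Sum>b\<in>B. (b \<bullet> x)\<^sup>2)"
proof -
  have *: "P x \<bullet> b = b \<bullet> x" if "b \<in> B" for b
  proof -
    have "b \<in> range P" using that B(4) span_base by blast
    then show ?thesis using assms(1,2) by (auto simp: inner_commute)
  qed
  have "P x = (\<Sum>b\<in>B. (P x \<bullet> b) *\<^sub>R b)"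
    using orthonormal_basis_expand[OF B(1,2) _ B(3), of "P x"] B(4) by auto
  then have "P x \<bullet> P x = P x \<bullet> (\<Sum>b\<in>B. (P x \<bullet> b) *\<^sub>R b)" by simp
  also have "\<dots> = (\<Sum>b\<in>B. (b \<bullet> x)\<^sup>2)"
    using * by (simp add: inner_sum_right power2_eq_square)
  finally show ?thesis by (simp add: power2_norm_eq_inner)
qed

text \<open>Orthonormal bases of the two perpendicular ranges are completed to one of the whole
  space, and f takes coordinates in it. Each projection then keeps its own block of coordinates, and
  the blocks are disjoint.\<close>

lemma orthogonal_projections_coordinates:
  fixes P Q :: "real^'n \<Rightarrow> real^'n"
  assumes P: "linear P" "\<And>x y. P x \<bullet> y = x \<bullet> P y" "\<And>x. P (P x) = P x"
    and Q: "linear Q" "\<And>x y. Q x \<bullet> y = x \<bullet> Q y" "\<And>x. Q (Q x) = Q x"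
    and PQ: "\<And>x. P (Q x) = 0"
  obtains f :: "real^'n \<Rightarrow> real^'n" and I J where "orthogonal_transformation f" "I \<inter> J = {}"
    "card I = dim (range P)" "card J = dim (range Q)"
    "\<And>x. (norm (P x))\<^sup>2 = (\<Sum>i\<in>I. (f x $ i)\<^sup>2)" "\<And>x. (norm (Q x))\<^sup>2 = (\<Sum>i\<in>J. (f x $ i)\<^sup>2)"
proof -
  have "subspace (range P)" "subspace (range Q)"
    using P(1) Q(1) by (auto intro: linear_subspace_image)
  obtain B1 where B1: "B1 \<subseteq> range P" "pairwise orthogonal B1" "\<And>x. x \<in> B1 \<Longrightarrow> norm x = 1"
      "independent B1" "card B1 = dim (range P)" "span B1 = range P"
    using orthonormal_basis_subspace[OF \<open>subspace (range P)\<close>] by metis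
  obtain B2 where B2: "B2 \<subseteq> range Q" "pairwise orthogonal B2" "\<And>x. x \<in> B2 \<Longrightarrow> norm x = 1"
      "independent B2" "card B2 = dim (range Q)" "span B2 = range Q"
    using orthonormal_basis_subspace[OF \<open>subspace (range Q)\<close>] by metis
  have o12: "orthogonal x y" if "x \<in> B1" "y \<in> B2" for x y
  proof -
    have "x \<in> range P" "y \<in> range Q" using that B1(1) B2(1) by auto
    then obtain u v where "x = P u" "y = Q v" by blast
    then show ?thesis by (simp add: orthogonal_def P(2) PQ)
  qed
  have "pairwise orthogonal (B1 \<union> B2)"
    using B1(2) B2(2) by (auto simp: pairwise_def intro: o12 o12[THEN orthogonal_commute[THEN iffD1]])
  define S where "S = span (B1 \<union> B2)"
  \<comment> \<open>The orthogonal complement of both ranges supplies the missing basis vectors, and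
    the dimension count makes the total exactly the size of the index type.\<close>
  define T where "T = {y \<in> UNIV. \<forall>x \<in> S. orthogonal x y}"
  have dimT: "dim T + dim S = CARD('n)"
    unfolding T_def using dim_subspace_orthogonal_to_vectors[of S UNIV] by (simp add: S_def)
  have "subspace T" unfolding T_def
    by (auto simp: subspace_def orthogonal_clauses)
  obtain B3 where B3: "B3 \<subseteq> T" "pairwise orthogonal B3" "\<And>x. x \<in> B3 \<Longrightarrow> norm x = 1"
      "independent B3" "card B3 = dim T" "span B3 = T"
    using orthonormal_basis_subspace[OF \<open>subspace T\<close>] by metis
  define B where "B = (B1 \<union> B2) \<union> B3"
  have norm_B: "norm x = 1" if "x \<in> B" for x using that B1 B2 B3 by (auto simp: B_def)
  have o3: "orthogonal x y" if "x \<in> B1 \<union> B2" "y \<in> B3" for x y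
    using that B3(1) span_base[of x "B1 \<union> B2"] by (auto simp: T_def S_def)
  have orth_B: "pairwise orthogonal B"
    using \<open>pairwise orthogonal (B1 \<union> B2)\<close> B3(2) unfolding B_def
    by (auto simp: pairwise_def intro: o3 o3[THEN orthogonal_commute[THEN iffD1]])
  have "0 \<notin> B" using norm_B by force
  then have ind: "independent B" using orth_B by (simp add: pairwise_orthogonal_independent)
  have "finite B" using ind by (rule independent_imp_finite)
  \<comment> \<open>A common element would be orthogonal to itself, hence zero, which is excluded by
    the unit norms.\<close>
  have disj: "B1 \<inter> B2 = {}" "(B1 \<union> B2) \<inter> B3 = {}"
    using o12 o3 \<open>0 \<notin> B\<close> unfolding B_def orthogonal_def by (metis Int_emptyI Un_iff inner_eq_zero_iff)+
  have "finite B1" "finite B2" "finite B3" using \<open>finite B\<close> by (auto simp: B_def)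
  have "independent (B1 \<union> B2)" using ind by (rule independent_mono) (auto simp: B_def)
  then have "card B = CARD('n)"
    using disj dimT \<open>finite B1\<close> \<open>finite B2\<close> \<open>finite B3\<close> B3(5)
    by (simp add: B_def card_Un_disjoint S_def dim_eq_card_independent)
  then have span_B: "span B = UNIV"
    using ind \<open>finite B\<close> card_ge_dim_independent[of B UNIV] by auto
  \<comment> \<open>The basis is enumerated by the index type itself, so that its coordinates again
    form a vector of the same type.\<close>
  obtain g where g: "bij_betw g (UNIV::'n set) B"
    using \<open>card B = CARD('n)\<close> \<open>finite B\<close> by (metis finite_class.finite_UNIV finite_same_card_bij)
  define f where "f x = (\<chi> i. g i \<bullet> x)" for x
  have sum_f: "(\<Sum>i\<in>g -` A. (f x $ i)\<^sup>2) = (\<Sum>b\<in>A. (b \<bullet> x)\<^sup>2)" if "A \<subseteq> B" for A x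
  proof -
    have "bij_betw g (g -` A) A"
      using g that by (auto simp: bij_betw_def inj_on_def)
    then show ?thesis by (simp add: f_def sum.reindex_bij_betw[symmetric])
  qed
  have card_g: "card (g -` A) = card A" if "A \<subseteq> B" for A
    using bij_betw_same_card[of g "g -` A" A] g that by (auto simp: bij_betw_def inj_on_def)
  have "orthogonal_transformation f"
    unfolding orthogonal_transformation
  proof
    show "linear f" by (auto simp: f_def linear_iff vec_eq_iff inner_add_right)
    show "\<forall>v. norm (f v) = norm v"
    proof
      fix v
      have "(norm (f v))\<^sup>2 = (\<Sum>i\<in>UNIV. (f v $ i)\<^sup>2)"
        by (simp add: norm_vec_def L2_set_def sum_nonneg)
      also have "UNIV = g -` B" using g by (auto simp: bij_betw_def)
      \<comment> \<open>Parseval for the full basis, taken as the case where the projection is the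
        identity.\<close>
      also have "(\<Sum>i\<in>g -` B. (f v $ i)\<^sup>2) = (norm v)\<^sup>2"
        using norm_projection_eq_sum[of id B v] orth_B norm_B \<open>finite B\<close> span_B
        by (simp add: sum_f)
      finally show "norm (f v) = norm v" by simp
    qed
  qed
  moreover have "(g -` B1) \<inter> (g -` B2) = {}" using disj by auto
  moreover have "B1 \<subseteq> B" "B2 \<subseteq> B" by (auto simp: B_def)
  ultimately show ?thesis
    using norm_projection_eq_sum[OF P(2,3) B1(2,3) \<open>finite B1\<close> B1(6)]
      norm_projection_eq_sum[OF Q(2,3) B2(2,3) \<open>finite B2\<close> B2(6)]
    by (intro that[of f "g -` B1" "g -` B2"]) (simp_all add: sum_f card_g B1(5) B2(5))
qed

section \<open>Gram matrices and projections onto column spaces\<close>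

lemma matrix_inv_inverse:
  assumes "invertible A"
  shows "A ** matrix_inv A = mat 1" "matrix_inv A ** A = mat 1"
  using assms someI_ex[of "\<lambda>B. A ** B = mat 1 \<and> B ** A = mat 1"]
  unfolding invertible_def matrix_inv_def by auto

text \<open>If the Gram matrix kills x, then pairing with x gives |A x|^2 = 0, and injectivity of A
  forces x = 0.\<close>

lemma invertible_gram:
  fixes A :: "real^'k^'l"
  assumes "inj ((*v) A)"
  shows "invertible (transpose A ** A)"
  unfolding invertible_left_inverse matrix_left_invertible_ker
proof (intro allI impI)
  fix x assume "(transpose A ** A) *v x = 0"
  then have "transpose A *v (A *v x) = 0" by (simp add: matrix_vector_mul_assoc)
  then have "(A *v x) \<bullet> (A *v x) = 0"
    by (metis dot_lmul_matrix inner_zero_right vector_transpose_matrix transpose_transpose)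
  then show "x = 0" using assms by (metis inj_eq inner_eq_zero_iff matrix_vector_mult_0_right)
qed

text \<open>The Gram matrix is symmetric, so the transposed inverse is again a left inverse of it,
  and such an inverse is unique.\<close>

lemma transpose_matrix_inv_gram:
  fixes A :: "real^'k^'l"
  assumes "inj ((*v) A)"
  shows "transpose (matrix_inv (transpose A ** A)) = matrix_inv (transpose A ** A)" (is "transpose ?G = ?G")
proof -
  note G = matrix_inv_inverse[OF invertible_gram[OF assms]]
  have "transpose ?G ** (transpose A ** A) = mat 1"
    using arg_cong[OF G(1), of transpose] by (simp add: matrix_transpose_mul transpose_mat)
  then show ?thesis
    by (metis G(1) matrix_mul_assoc matrix_mul_lid matrix_mul_rid)
qed

text \<open>For injective A this is the orthogonal projection onto the column space; for the design
  matrix it maps the observations to the fitted values.\<close>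

definition hat_matrix :: "real^'k^'l \<Rightarrow> real^'l^'l" where
  "hat_matrix A = A ** matrix_inv (transpose A ** A) ** transpose A"

lemma inner_transpose_matrix:
  fixes A :: "real^'k^'l"
  shows "(A *v x) \<bullet> y = x \<bullet> (transpose A *v y)"
  by (metis dot_lmul_matrix vector_transpose_matrix transpose_transpose)

lemma
  fixes A :: "real^'k^'l"
  assumes inj: "inj ((*v) A)"
  shows hat_matrix_mult: "hat_matrix A ** A = A"
    and transpose_hat_matrix: "transpose (hat_matrix A) = hat_matrix A"
    and hat_matrix_idem: "hat_matrix A ** hat_matrix A = hat_matrix A"
    and range_hat_matrix: "range ((*v) (hat_matrix A)) = range ((*v) A)"
proof -
  show *: "hat_matrix A ** A = A"
    by (simp add: hat_matrix_def matrix_mul_assoc[symmetric] matrix_inv_inverse[OF invertible_gram[OF inj]])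
  show "transpose (hat_matrix A) = hat_matrix A"
    by (simp add: hat_matrix_def matrix_transpose_mul transpose_matrix_inv_gram[OF inj] matrix_mul_assoc)
  show "hat_matrix A ** hat_matrix A = hat_matrix A"
    using * by (simp add: hat_matrix_def matrix_mul_assoc)
  have "hat_matrix A *v x \<in> range ((*v) A)" for x
    by (simp add: hat_matrix_def matrix_vector_mul_assoc[symmetric])
  moreover have "A *v x \<in> range ((*v) (hat_matrix A))" for x
    using * by (metis matrix_vector_mul_assoc rangeI)
  ultimately show "range ((*v) (hat_matrix A)) = range ((*v) A)" by auto
qed

text \<open>P projects onto the column space of A = X G C, and Q is the residual map y - H y of the
  projection H onto the column space of X. The columns of A lie in the range of H, so P annihilates
  all residuals.\<close>

lemma regression_quadratic_forms:
  fixes X :: "real^'p^'n" and C :: "real^'s^'p"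
  defines "G \<equiv> matrix_inv (transpose X ** X)"
  defines "V \<equiv> transpose C ** G ** C"
  assumes X: "rank X = CARD('p)" and C: "rank C = CARD('s)"
  obtains P Q :: "real^'n \<Rightarrow> real^'n" where
    "linear P" "\<And>x y. P x \<bullet> y = x \<bullet> P y" "\<And>x. P (P x) = P x" "dim (range P) = CARD('s)"
    "linear Q" "\<And>x y. Q x \<bullet> y = x \<bullet> Q y" "\<And>x. Q (Q x) = Q x" "dim (range Q) = CARD('n) - CARD('p)"
    "\<And>x. P (Q x) = 0"
    "\<And>e. (transpose C *v (G *v (transpose X *v e))) \<bullet> (matrix_inv V *v (transpose C *v (G *v (transpose X *v e)))) = (norm (P e))\<^sup>2"
    "\<And>b e. X *v b + e - X *v lse X (X *v b + e) = Q e"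
proof -
  have injX: "inj ((*v) X)" and injC: "inj ((*v) C)" using X C by (simp_all add: full_rank_injective)
  note GX = matrix_inv_inverse[OF invertible_gram[OF injX], folded G_def]
  have GT: "transpose G = G" unfolding G_def by (rule transpose_matrix_inv_gram[OF injX])
  \<comment> \<open>Chosen so that A^T e is the error C^T G X^T e of the estimated contrasts.
    Because G inverts X^T X, the Gram matrix of A collapses to \<open>V\<close>, and the quadratic
    form becomes e^T (A V^{-1} A^T) e with the hat matrix of A in the middle.\<close>
  define A where "A = X ** G ** C"
  have AT: "transpose A = transpose C ** G ** transpose X"
    by (simp add: A_def matrix_transpose_mul GT matrix_mul_assoc)
  have "transpose A ** A = transpose C ** ((G ** (transpose X ** X)) ** (G ** C))"
    unfolding AT unfolding A_def by (simp only: matrix_mul_assoc)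
  then have "transpose A ** A = transpose C ** (G ** C)" by (simp only: GX matrix_mul_lid)
  then have V: "transpose A ** A = V" by (simp only: V_def matrix_mul_assoc)
  have injA: "inj ((*v) A)"
  proof (rule injI)
    fix x y assume "A *v x = A *v y"
    then have "X *v (G *v (C *v x)) = X *v (G *v (C *v y))" by (simp add: A_def matrix_vector_mul_assoc matrix_mul_assoc)
    then have "G *v (C *v x) = G *v (C *v y)" using injX by (simp add: inj_eq)
    then have "C *v x = C *v y" using GX(1) by (metis matrix_vector_mul_assoc matrix_vector_mul_lid)
    then show "x = y" using injC by (simp add: inj_eq)
  qed
  define P where "P = (*v) (hat_matrix A)"
  define H where "H = (*v) (hat_matrix X)"
  define Q where "Q x = x - H x" for x
  have linH: "linear H" and linP: "linear P" unfolding H_def P_def by auto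
  have HH: "H (H x) = H x" for x
    by (simp add: H_def matrix_vector_mul_assoc hat_matrix_idem[OF injX])
  have Hsym: "H x \<bullet> y = x \<bullet> H y" for x y
    unfolding H_def by (subst inner_transpose_matrix) (simp add: transpose_hat_matrix[OF injX])
  \<comment> \<open>H fixes the columns of A; transposing this identity gives A^T H = A^T, since H
    is symmetric.\<close>
  have PH: "P (H x) = P x" for x
  proof -
    have "hat_matrix X ** A = A"
      unfolding A_def using hat_matrix_mult[OF injX] by (simp add: matrix_mul_assoc)
    from arg_cong[OF this, of transpose] have "transpose A ** hat_matrix X = transpose A"
      by (simp add: matrix_transpose_mul transpose_hat_matrix[OF injX])
    then have "hat_matrix A ** hat_matrix X = hat_matrix A"
      unfolding hat_matrix_def[of A] by (simp add: matrix_mul_assoc[symmetric])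
    then show ?thesis by (simp add: P_def H_def matrix_vector_mul_assoc)
  qed
  show ?thesis
  proof (rule that[of P Q])
    show "linear P" by fact
    show "P x \<bullet> y = x \<bullet> P y" for x y
      unfolding P_def by (subst inner_transpose_matrix) (simp add: transpose_hat_matrix[OF injA])
    show "P (P x) = P x" for x
      by (simp add: P_def matrix_vector_mul_assoc hat_matrix_idem[OF injA])
    show "dim (range P) = CARD('s)"
      using injA by (simp add: P_def range_hat_matrix rank_dim_range[symmetric] full_rank_injective)
    show "linear Q" using linH unfolding Q_def by (intro linear_compose_sub linear_ident)
    show "Q x \<bullet> y = x \<bullet> Q y" for x y by (simp add: Q_def inner_diff Hsym)
    show "Q (Q x) = Q x" for x by (simp add: Q_def linear_diff[OF linH] HH)
    show "P (Q x) = 0" for x by (simp add: Q_def linear_diff[OF linP] PH)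
    have rH: "range H = range ((*v) X)" unfolding H_def by (rule range_hat_matrix[OF injX])
    \<comment> \<open>Identifying the residuals with the orthogonal complement of the column space
      of X yields their dimension n - p.\<close>
    have "range Q = {y \<in> UNIV. \<forall>x \<in> range H. orthogonal x y}"
    proof (intro equalityI subsetI)
      fix y assume "y \<in> range Q"
      then show "y \<in> {y \<in> UNIV. \<forall>x \<in> range H. orthogonal x y}"
        by (auto simp: orthogonal_def Q_def Hsym HH linear_diff[OF linH])
    next
      fix y assume "y \<in> {y \<in> UNIV. \<forall>x \<in> range H. orthogonal x y}"
      then have "H (H y) \<bullet> y = 0" by (auto simp: orthogonal_def)
      moreover have "H (H y) \<bullet> y = H y \<bullet> H y" by (rule Hsym)
      ultimately have "H y = 0" by simp
      then have "y = Q y" by (simp add: Q_def)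
      then show "y \<in> range Q" by (rule range_eqI)
    qed
    moreover have "dim (range H) = CARD('p)" using X by (simp add: rH rank_dim_range)
    moreover have "subspace (range H)" using linH by (intro linear_subspace_image) auto
    ultimately show "dim (range Q) = CARD('n) - CARD('p)"
      using dim_subspace_orthogonal_to_vectors[of "range H" UNIV] by simp
    show "(transpose C *v (G *v (transpose X *v e))) \<bullet> (matrix_inv V *v (transpose C *v (G *v (transpose X *v e)))) = (norm (P e))\<^sup>2" for e
    proof -
      have "(norm (P e))\<^sup>2 = P e \<bullet> e"
        by (simp add: power2_norm_eq_inner \<open>\<And>x y. P x \<bullet> y = x \<bullet> P y\<close> \<open>\<And>x. P (P x) = P x\<close>)
      also have "\<dots> = (A *v (matrix_inv V *v (transpose A *v e))) \<bullet> e"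
        by (simp only: P_def hat_matrix_def V matrix_vector_mul_assoc matrix_mul_assoc)
      also have "\<dots> = (matrix_inv V *v (transpose A *v e)) \<bullet> (transpose A *v e)"
        by (rule inner_transpose_matrix)
      also have "transpose A *v e = transpose C *v (G *v (transpose X *v e))"
        by (simp only: AT matrix_vector_mul_assoc matrix_mul_assoc)
      finally show ?thesis by (simp only: inner_commute)
    qed
    show "X *v b + e - X *v lse X (X *v b + e) = Q e" for b e
    proof -
      have "X *v lse X y = H y" for y
        by (simp only: lse_def H_def hat_matrix_def matrix_vector_mul_assoc matrix_mul_assoc)
      moreover have "H (X *v b) = X *v b"
        by (simp add: H_def matrix_vector_mul_assoc hat_matrix_mult[OF injX])
      ultimately show ?thesis by (simp add: Q_def linear_add[OF linH])
    qed
  qed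
qed

section \<open>Independent chi variables from orthogonal projections\<close>

text \<open>Rotation invariance speaks about the joint law. This equivalence passes from independent
  coordinates to that law before the rotation and back to independent coordinates after it.\<close>

lemma (in prob_space) indep_vars_std_normal_iff_distr:
  fixes Z :: "'i::finite \<Rightarrow> 'a \<Rightarrow> real"
  assumes [measurable]: "\<And>i. Z i \<in> borel_measurable M"
  shows "indep_vars (\<lambda>_. borel) Z UNIV \<and> (\<forall>i. distr M borel (Z i) = density lborel std_normal_density)
    \<longleftrightarrow> distr M (Pi\<^sub>M UNIV (\<lambda>_. borel)) (\<lambda>\<omega> i. Z i \<omega>) = Pi\<^sub>M UNIV (\<lambda>_. density lborel std_normal_density)"
proof -
  interpret N: prob_space "density lborel (\<lambda>x. ennreal (std_normal_density x))"
    by (rule prob_space_normal_density) simp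
  have ZP[measurable]: "(\<lambda>\<omega> i. Z i \<omega>) \<in> M \<rightarrow>\<^sub>M Pi\<^sub>M UNIV (\<lambda>_::'i. borel)"
    by (rule measurable_PiM_single') auto
  have marg: "distr M borel (Z i) = density lborel std_normal_density"
    if law: "distr M (Pi\<^sub>M UNIV (\<lambda>_. borel)) (\<lambda>\<omega> i. Z i \<omega>) = Pi\<^sub>M UNIV (\<lambda>_. density lborel std_normal_density)" for i
  proof -
    have "distr M borel (Z i) = distr (distr M (Pi\<^sub>M UNIV (\<lambda>_. borel)) (\<lambda>\<omega> i. Z i \<omega>)) borel (\<lambda>x. x i)"
      by (subst distr_distr) (auto simp: comp_def)
    also have "\<dots> = distr (Pi\<^sub>M UNIV (\<lambda>_. density lborel std_normal_density)) (density lborel std_normal_density) (\<lambda>x. x i)"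
      unfolding law by (intro distr_cong) auto
    also have "\<dots> = density lborel std_normal_density"
      by (rule distr_PiM_component[where M = "\<lambda>_. density lborel std_normal_density"]) (auto intro: N.prob_space_axioms)
    finally show ?thesis .
  qed
  show ?thesis
    using marg indep_vars_iff_distr_eq_PiM[where I = UNIV and M' = "\<lambda>_. borel" and X = Z] by (auto simp: restrict_UNIV)
qed

lemma (in prob_space) norm_std_normal_coordinates:
  assumes ind: "indep_vars (\<lambda>_. borel) Z A" and law: "\<And>i. i \<in> A \<Longrightarrow> distr M borel (Z i) = density lborel std_normal_density"
    and I: "I \<subseteq> A" "finite I" "I \<noteq> {}"
  shows "distributed M lborel (\<lambda>\<omega>. sqrt (\<Sum>i\<in>I. (Z i \<omega>)\<^sup>2)) (chi_density (card I))"
proof -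
  have Z: "Z i \<in> borel_measurable M" if "i \<in> I" for i
    using ind that I by (auto simp: indep_vars_def)
  have ZP: "(\<lambda>\<omega>. \<lambda>i\<in>I. Z i \<omega>) \<in> M \<rightarrow>\<^sub>M Pi\<^sub>M I (\<lambda>_. borel)"
    by (rule measurable_restrict) (rule Z)
  have T: "(\<lambda>x. sqrt (\<Sum>i\<in>I. (x i)\<^sup>2)) \<in> borel_measurable (Pi\<^sub>M I (\<lambda>_. borel))"
    using I by measurable
  have "distr M (Pi\<^sub>M I (\<lambda>_. borel)) (\<lambda>\<omega>. \<lambda>i\<in>I. Z i \<omega>) = Pi\<^sub>M I (\<lambda>i. distr M borel (Z i))"
    using indep_vars_iff_distr_eq_PiM'[OF I(3), where M' = "\<lambda>_. borel" and X = Z] Z indep_vars_subset[OF ind I(1)] by auto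
  also have "\<dots> = Pi\<^sub>M I (\<lambda>_. density lborel std_normal_density)"
    using law I by (intro PiM_cong) auto
  finally have *: "distr M (Pi\<^sub>M I (\<lambda>_. borel)) (\<lambda>\<omega>. \<lambda>i\<in>I. Z i \<omega>) = Pi\<^sub>M I (\<lambda>_. density lborel std_normal_density)" .
  have "distr M lborel (\<lambda>\<omega>. sqrt (\<Sum>i\<in>I. (Z i \<omega>)\<^sup>2)) = distr M borel (\<lambda>\<omega>. sqrt (\<Sum>i\<in>I. (Z i \<omega>)\<^sup>2))"
    by (rule distr_cong) auto
  also have "\<dots> = distr (distr M (Pi\<^sub>M I (\<lambda>_. borel)) (\<lambda>\<omega>. \<lambda>i\<in>I. Z i \<omega>)) borel (\<lambda>x. sqrt (\<Sum>i\<in>I. (x i)\<^sup>2))"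
    by (subst distr_distr[OF T ZP]) (simp add: comp_def)
  also have "\<dots> = density lborel (chi_density (card I))"
    unfolding * by (rule distr_norm_std_normal[OF I(2,3)])
  finally show ?thesis
    using I Z by (auto simp: distributed_def)
qed

text \<open>In rotated coordinates, which are again independent standard normal, the two norms are
  functions of disjoint blocks; the block sizes are the degrees of freedom.\<close>

lemma (in prob_space) norm_orthogonal_projections:
  fixes Z :: "'n::finite \<Rightarrow> 'a \<Rightarrow> real" and P Q :: "real^'n \<Rightarrow> real^'n"
  assumes ind: "indep_vars (\<lambda>_. borel) Z UNIV" and law: "\<And>i. distr M borel (Z i) = density lborel std_normal_density"
    and P: "linear P" "\<And>x y. P x \<bullet> y = x \<bullet> P y" "\<And>x. P (P x) = P x" "dim (range P) > 0"
    and Q: "linear Q" "\<And>x y. Q x \<bullet> y = x \<bullet> Q y" "\<And>x. Q (Q x) = Q x" "dim (range Q) > 0"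
    and PQ: "\<And>x. P (Q x) = 0"
  shows "distributed M lborel (\<lambda>\<omega>. norm (P (\<chi> i. Z i \<omega>))) (chi_density (dim (range P)))"
    and "distributed M lborel (\<lambda>\<omega>. norm (Q (\<chi> i. Z i \<omega>))) (chi_density (dim (range Q)))"
    and "indep_var borel (\<lambda>\<omega>. norm (P (\<chi> i. Z i \<omega>))) borel (\<lambda>\<omega>. norm (Q (\<chi> i. Z i \<omega>)))"
proof -
  obtain f :: "real^'n \<Rightarrow> real^'n" and I J where f: "orthogonal_transformation f" and IJ: "I \<inter> J = {}"
    "card I = dim (range P)" "card J = dim (range Q)"
    and sq: "\<And>x. (norm (P x))\<^sup>2 = (\<Sum>i\<in>I. (f x $ i)\<^sup>2)" "\<And>x. (norm (Q x))\<^sup>2 = (\<Sum>i\<in>J. (f x $ i)\<^sup>2)"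
    using orthogonal_projections_coordinates[OF P(1-3) Q(1-3) PQ] by metis
  have [measurable]: "Z i \<in> borel_measurable M" for i using ind by (auto simp: indep_vars_def)
  define Z' where "Z' i \<omega> = f (\<chi> j. Z j \<omega>) $ i" for i \<omega>
  have nP: "norm (P (\<chi> i. Z i \<omega>)) = sqrt (\<Sum>i\<in>I. (Z' i \<omega>)\<^sup>2)" for \<omega>
    unfolding Z'_def sq(1)[symmetric] by simp
  have nQ: "norm (Q (\<chi> i. Z i \<omega>)) = sqrt (\<Sum>i\<in>J. (Z' i \<omega>)\<^sup>2)" for \<omega>
    unfolding Z'_def sq(2)[symmetric] by simp
  have lin: "linear f" using f by (rule orthogonal_transformation_linear)
  then have f_meas: "f \<in> borel_measurable borel"
    by (intro borel_measurable_continuous_onI linear_continuous_on) (simp add: linear_linear)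
  have z_meas: "(\<lambda>\<omega>. \<chi> i. Z i \<omega>) \<in> borel_measurable M"
    by (rule borel_measurable_euclidean_space[THEN iffD2]) (auto simp: Basis_vec_def inner_axis)
  have Z'_meas: "Z' i \<in> borel_measurable M" for i
    unfolding Z'_def by (rule measurable_compose[OF measurable_compose[OF z_meas f_meas] borel_measurable_nth])
  have "distr M (Pi\<^sub>M UNIV (\<lambda>_. borel)) (\<lambda>\<omega> i. Z i \<omega>) = Pi\<^sub>M UNIV (\<lambda>_. density lborel std_normal_density)"
    using indep_vars_std_normal_iff_distr[of Z] ind law by auto
  then have "distr M (Pi\<^sub>M UNIV (\<lambda>_. borel)) (\<lambda>\<omega> i. Z' i \<omega>) = Pi\<^sub>M UNIV (\<lambda>_. density lborel std_normal_density)"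
    unfolding Z'_def by (intro orthogonal_image_std_normal f) auto
  then have ind': "indep_vars (\<lambda>_. borel) Z' UNIV" and law': "\<And>i. distr M borel (Z' i) = density lborel std_normal_density"
    using indep_vars_std_normal_iff_distr[of Z'] Z'_meas by auto
  have "card I > 0" "card J > 0" using P(4) Q(4) by (simp_all only: IJ)
  then have ne: "I \<noteq> {}" "J \<noteq> {}" by auto
  show "distributed M lborel (\<lambda>\<omega>. norm (P (\<chi> i. Z i \<omega>))) (chi_density (dim (range P)))"
    unfolding nP IJ(2)[symmetric] by (rule norm_std_normal_coordinates[OF ind' law']) (use ne in auto)
  show "distributed M lborel (\<lambda>\<omega>. norm (Q (\<chi> i. Z i \<omega>))) (chi_density (dim (range Q)))"
    unfolding nQ IJ(3)[symmetric] by (rule norm_std_normal_coordinates[OF ind' law']) (use ne in auto)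
  have "(\<lambda>x. sqrt (\<Sum>i\<in>K. (x i)\<^sup>2)) \<in> borel_measurable (Pi\<^sub>M K (\<lambda>_. borel))" for K :: "'n set"
    by measurable
  from indep_var_compose[OF indep_var_restrict[OF ind' IJ(1) subset_UNIV subset_UNIV] this this]
  show "indep_var borel (\<lambda>\<omega>. norm (P (\<chi> i. Z i \<omega>))) borel (\<lambda>\<omega>. norm (Q (\<chi> i. Z i \<omega>)))"
    by (simp add: nP nQ comp_def)
qed

section \<open>The weighted ratio of independent chi variables\<close>

text \<open>The density of sqrt F under the measure weighted by W. It integrates to E(W), so it is
  not a probability density.\<close>

definition ratio_density :: "nat \<Rightarrow> nat \<Rightarrow> real \<Rightarrow> real" where
  "ratio_density s m x = indicator {0..} x
     * (2 powr (3/2) * real s powr (real s / 2) * Gamma ((real s + real m + 1) / 2)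
         / (Gamma (real m / 2) * Gamma (real s / 2)))
     * (x ^ (s - 1) * real m powr (real m / 2) / (real s * x\<^sup>2 + real m) powr ((real s + real m + 1) / 2))"

lemma borel_measurable_ratio_density [measurable]: "ratio_density s m \<in> borel_measurable borel"
  unfolding ratio_density_def by measurable

lemma ratio_density_nonneg:
  assumes "s > 0" "m > 0"
  shows "0 \<le> ratio_density s m x"
proof -
  have "Gamma ((real s + real m + 1) / 2) > 0" "Gamma (real m / 2) > 0" "Gamma (real s / 2) > 0"
    using assms by (auto intro!: Gamma_real_pos)
  then show ?thesis by (auto simp: ratio_density_def indicator_def)
qed

text \<open>For fixed u > 0 the substitution r = u x / c turns the argument of h into x, after which
  h no longer depends on u. Interchanging the integrals leaves a Gaussian moment in u.\<close>

lemma nn_integral_chi_ratio: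
  assumes "s > 0" "m > 0" and [measurable]: "h \<in> borel_measurable borel"
  shows "(\<integral>\<^sup>+u. \<integral>\<^sup>+r. ennreal (chi_density s r * chi_density m u) * (ennreal (u / sqrt m) * h (sqrt (real m / real s) * r / u)) \<partial>lborel \<partial>lborel)
    = (\<integral>\<^sup>+x. ennreal (ratio_density s m x) * h x \<partial>lborel)"
proof -
  define c where "c = sqrt (real m / real s)"
  have c: "c > 0" using assms by (simp add: c_def)
  have c2: "c\<^sup>2 = real m / real s" using assms by (simp add: c_def)
  define Ds where "Ds = 2 powr (real s / 2 - 1) * Gamma (real s / 2)"
  define Dm where "Dm = 2 powr (real m / 2 - 1) * Gamma (real m / 2)"
  have G: "Gamma ((real s + real m + 1) / 2) > 0" "Gamma (real m / 2) > 0" "Gamma (real s / 2) > 0"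
    using assms by (auto intro!: Gamma_real_pos)
  then have D: "Ds > 0" "Dm > 0" by (simp_all add: Ds_def Dm_def)
  \<comment> \<open>The joint integrand in (x, u) after the substitution. The power of u collects
    one factor from the Jacobian, s - 1 and m - 1 from the densities and one from the weight, s + m
    in all; it is written \<open>Suc (s + m) - 1\<close> to match the moment formula with N = s + m
    + 1.\<close>
  define K where "K x u = indicator {0..} x * x ^ (s - 1) / (c ^ s * sqrt m * Ds * Dm)
       * (indicator {0..} u * u ^ (Suc (s + m) - 1) * exp (- (1 + x\<^sup>2 / c\<^sup>2) * u\<^sup>2 / 2))" for x u :: real
  have K_meas[measurable]: "(\<lambda>(u, x). K x u) \<in> borel_measurable (borel \<Otimes>\<^sub>M borel)"
    unfolding K_def by measurable
  have [measurable]: "K x \<in> borel_measurable borel" for x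
    unfolding K_def by measurable
  have inner: "(\<integral>\<^sup>+r. ennreal (chi_density s r * chi_density m u) * (ennreal (u / sqrt m) * h (c * r / u)) \<partial>lborel)
     = (\<integral>\<^sup>+x. ennreal (K x u) * h x \<partial>lborel)" for u
  proof (cases "u > 0")
    case False
    \<comment> \<open>For u < 0 the density vanishes. At u = 0 the weight does, which is needed when
      m = 1, where the density itself is positive.\<close>
    then have "chi_density m u * (u / sqrt m) = 0" by (auto simp: chi_density_def)
    then have L: "ennreal (chi_density s r * chi_density m u) * (ennreal (u / sqrt m) * h (c * r / u)) = 0" for r
      by auto
    have "K x u = 0" for x using False by (cases "u = 0") (auto simp: K_def)
    then show ?thesis by (simp only: L ennreal_0 mult_zero_left)
  next
    case True
    have K: "u / c * (chi_density s (0 + u / c * x) * chi_density m u * (u / sqrt m)) = K x u" for x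
    proof -
      have e: "exp (- (u * x / c)\<^sup>2 / 2) * exp (- u\<^sup>2 / 2) = exp (- (1 + x\<^sup>2 / c\<^sup>2) * u\<^sup>2 / 2)"
        by (simp add: exp_add[symmetric] power_mult_distrib power_divide field_simps)
      have i: "indicator {0..} (u * x / c) = (indicator {0..} x :: real)" "indicator {0..} u = (1::real)"
        using True c by (auto simp: indicator_def zero_le_mult_iff zero_le_divide_iff)
      have "u / c * (chi_density s (0 + u / c * x) * chi_density m u * (u / sqrt m))
        = indicator {0..} x * (u / c * (u * x / c) ^ (s - 1) * u ^ (m - 1) * (u / sqrt m))
            / (Ds * Dm) * (exp (- (u * x / c)\<^sup>2 / 2) * exp (- u\<^sup>2 / 2))"
        by (simp add: chi_density_def i Ds_def Dm_def mult_ac)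
      also have "u / c * (u * x / c) ^ (s - 1) * u ^ (m - 1) * (u / sqrt m)
        = x ^ (s - 1) / (c ^ s * sqrt m) * u ^ (s + m)"
        using assms c by (simp add: power_mult_distrib power_divide power_add power_eq_if[of _ s] power_eq_if[of _ m])
      finally show ?thesis unfolding e K_def by (simp add: i)
    qed
    have "(\<integral>\<^sup>+r. ennreal (chi_density s r * chi_density m u) * (ennreal (u / sqrt m) * h (c * r / u)) \<partial>lborel)
      = ennreal (u / c) * (\<integral>\<^sup>+x. ennreal (chi_density s (0 + u / c * x) * chi_density m u) * (ennreal (u / sqrt m) * h (c * (0 + u / c * x) / u)) \<partial>lborel)"
      using True c by (subst nn_integral_real_affine[of _ "u / c" 0]) auto
    also have "\<dots> = (\<integral>\<^sup>+x. ennreal (u / c) * (ennreal (chi_density s (0 + u / c * x) * chi_density m u) * (ennreal (u / sqrt m) * h (c * (0 + u / c * x) / u))) \<partial>lborel)"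
      by (rule nn_integral_cmult[symmetric]) measurable
    also have "\<dots> = (\<integral>\<^sup>+x. ennreal (K x u) * h x \<partial>lborel)"
    proof (rule nn_integral_cong)
      fix x
      have mult3: "ennreal p * (ennreal q * ennreal r) = ennreal (p * (q * r))" if "p \<ge> 0" "q \<ge> 0" for p q r
        using that by (simp add: ennreal_mult')
      have "c * (0 + u / c * x) / u = x" using True c by simp
      moreover have "ennreal (u / c) * (ennreal (chi_density s (0 + u / c * x) * chi_density m u) * ennreal (u / sqrt m)) = ennreal (K x u)"
        unfolding K[symmetric] using True c by (intro mult3) (simp_all add: chi_density_nonneg)
      ultimately show "ennreal (u / c) * (ennreal (chi_density s (0 + u / c * x) * chi_density m u) * (ennreal (u / sqrt m) * h (c * (0 + u / c * x) / u)))
        = ennreal (K x u) * h x"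
        by (simp only: mult.assoc[symmetric])
    qed
    finally show ?thesis .
  qed
  have int_K: "(\<integral>\<^sup>+u. ennreal (K x u) \<partial>lborel) = ennreal (ratio_density s m x)" for x
  proof (cases "x \<ge> 0")
    case False
    then show ?thesis by (simp add: K_def ratio_density_def)
  next
    case True
    let ?q = "(real s + real m + 1) / 2"
    define A where "A = x ^ (s - 1) / (c ^ s * sqrt m * Ds * Dm)"
    have A: "A \<ge> 0" unfolding A_def using True c D by simp
    have pos: "1 + x\<^sup>2 / c\<^sup>2 > 0" using c by (simp add: add_pos_nonneg)
    have "(\<integral>\<^sup>+u. ennreal (K x u) \<partial>lborel)
      = (\<integral>\<^sup>+u. ennreal A * ennreal (indicator {0..} u * u ^ (Suc (s + m) - 1) * exp (- (1 + x\<^sup>2 / c\<^sup>2) * u\<^sup>2 / 2)) \<partial>lborel)"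
      using True A by (intro nn_integral_cong) (simp add: K_def A_def ennreal_mult'[symmetric])
    also have "\<dots> = ennreal A * ennreal (2 powr (real (Suc (s + m)) / 2 - 1) * Gamma (real (Suc (s + m)) / 2)
        / (1 + x\<^sup>2 / c\<^sup>2) powr (real (Suc (s + m)) / 2))"
      using pos by (subst nn_integral_cmult) (simp_all only: nn_integral_power_gaussian[OF zero_less_Suc], measurable)
    also have "\<dots> = ennreal (A * (2 powr (?q - 1) * Gamma ?q / (1 + x\<^sup>2 / c\<^sup>2) powr ?q))"
      using A by (simp add: ennreal_mult'[symmetric] add_ac)
    also have "A * (2 powr (?q - 1) * Gamma ?q / (1 + x\<^sup>2 / c\<^sup>2) powr ?q) = ratio_density s m x"
    proof -
      have q: "(1 + x\<^sup>2 / c\<^sup>2) powr ?q = (real s * x\<^sup>2 + real m) powr ?q / real m powr ?q"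
      proof -
        have "1 + x\<^sup>2 / c\<^sup>2 = (real s * x\<^sup>2 + real m) / real m" using assms unfolding c2 by (simp add: field_simps)
        then show ?thesis using assms by (simp add: powr_divide)
      qed
      have cs: "c ^ s = real m powr (real s / 2) / real s powr (real s / 2)"
        using assms unfolding c_def by (simp add: powr_half_sqrt[symmetric] powr_power powr_divide power_divide)
      have m: "real m powr ?q / (real m powr (real s / 2) * sqrt m) = real m powr (real m / 2)"
      proof -
        have "real m powr (real s / 2) * sqrt m * real m powr (real m / 2) = real m powr ?q"
          using assms by (simp add: powr_half_sqrt[symmetric] powr_add[symmetric] add_divide_distrib add_ac)
        then show ?thesis using assms by (simp add: field_simps)
      qed
      \<comment> \<open>Origin of 2^(3/2): with q = (s + m + 1)/2 the exponent is (q - 1) - (s/2 -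
        1) - (m/2 - 1) = 3/2.\<close>
      have two: "2 powr (?q - 1) / (2 powr (real s / 2 - 1) * 2 powr (real m / 2 - 1)) = 2 powr (3 / 2 :: real)"
        by (simp add: powr_add[symmetric] powr_diff[symmetric] field_simps)
      have "A * (2 powr (?q - 1) * Gamma ?q / (1 + x\<^sup>2 / c\<^sup>2) powr ?q)
        = (2 powr (?q - 1) / (2 powr (real s / 2 - 1) * 2 powr (real m / 2 - 1)))
          * real s powr (real s / 2) * Gamma ?q / (Gamma (real m / 2) * Gamma (real s / 2))
          * (x ^ (s - 1) * (real m powr ?q / (real m powr (real s / 2) * sqrt m)) / (real s * x\<^sup>2 + real m) powr ?q)"
        unfolding q A_def cs Ds_def Dm_def using assms by (simp add: mult_ac)
      also have "\<dots> = ratio_density s m x"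
        unfolding m two ratio_density_def using True by simp
      finally show ?thesis .
    qed
    finally show ?thesis .
  qed
  have "(\<integral>\<^sup>+u. \<integral>\<^sup>+r. ennreal (chi_density s r * chi_density m u) * (ennreal (u / sqrt m) * h (c * r / u)) \<partial>lborel \<partial>lborel)
    = (\<integral>\<^sup>+u. \<integral>\<^sup>+x. ennreal (K x u) * h x \<partial>lborel \<partial>lborel)"
    by (simp only: inner)
  also have "\<dots> = (\<integral>\<^sup>+x. \<integral>\<^sup>+u. ennreal (K x u) * h x \<partial>lborel \<partial>lborel)"
    by (rule lborel_pair.Fubini'[symmetric]) measurable
  also have "\<dots> = (\<integral>\<^sup>+x. ennreal (ratio_density s m x) * h x \<partial>lborel)"
    by (simp add: nn_integral_multc int_K)
  finally show ?thesis by (simp only: c_def)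
qed

text \<open>Stating the result as an equality of measures lets integrals and integrability for
  signed integrands both be transferred from it. It is checked on indicators through the joint
  density, which is a product by independence.\<close>

lemma (in prob_space) distr_weighted_chi_ratio:
  fixes R U :: "'a \<Rightarrow> real"
  assumes "s > 0" "m > 0"
    and R: "distributed M lborel R (chi_density s)" and U: "distributed M lborel U (chi_density m)"
    and indep: "indep_var borel R borel U"
  shows "distr (density M (\<lambda>\<omega>. ennreal (U \<omega> / sqrt m))) borel (\<lambda>\<omega>. sqrt (real m / real s) * R \<omega> / U \<omega>)
    = density lborel (ratio_density s m)"
proof (rule measure_eqI)
  have [measurable]: "R \<in> borel_measurable M" "U \<in> borel_measurable M"
    using R U by (auto simp: distributed_def)
  have indep': "indep_var lborel R lborel U"
    using indep_var_compose[OF indep, of "\<lambda>x. x" lborel "\<lambda>x. x" lborel] by (simp add: comp_def)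
  fix A assume "A \<in> sets (distr (density M (\<lambda>\<omega>. ennreal (U \<omega> / sqrt m))) borel (\<lambda>\<omega>. sqrt (real m / real s) * R \<omega> / U \<omega>))"
  then have [measurable]: "A \<in> sets borel" by simp
  let ?h = "indicator A :: real \<Rightarrow> ennreal"
  have "emeasure (distr (density M (\<lambda>\<omega>. ennreal (U \<omega> / sqrt m))) borel (\<lambda>\<omega>. sqrt (real m / real s) * R \<omega> / U \<omega>)) A
    = (\<integral>\<^sup>+\<omega>. ?h \<omega> \<partial>distr (density M (\<lambda>\<omega>. ennreal (U \<omega> / sqrt m))) borel (\<lambda>\<omega>. sqrt (real m / real s) * R \<omega> / U \<omega>))"
    by simp
  also have "\<dots> = (\<integral>\<^sup>+\<omega>. ennreal (U \<omega> / sqrt m) * ?h (sqrt (real m / real s) * R \<omega> / U \<omega>) \<partial>M)"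
    by (subst nn_integral_distr, simp, simp, subst nn_integral_density) auto
  also have "\<dots> = (\<integral>\<^sup>+\<omega>. (\<lambda>(r, u). ennreal (u / sqrt m) * ?h (sqrt (real m / real s) * r / u)) (R \<omega>, U \<omega>) \<partial>M)"
    by simp
  also have "\<dots> = (\<integral>\<^sup>+p. (case p of (r, u) \<Rightarrow> ennreal (chi_density s r) * ennreal (chi_density m u)) * (\<lambda>(r, u). ennreal (u / sqrt m) * ?h (sqrt (real m / real s) * r / u)) p \<partial>(lborel \<Otimes>\<^sub>M lborel))"
    by (rule distributed_nn_integral[symmetric, OF distributed_joint_indep[OF _ _ R U indep']])
      (auto intro: lborel.sigma_finite_measure_axioms)
  also have "\<dots> = (\<integral>\<^sup>+u. \<integral>\<^sup>+r. ennreal (chi_density s r * chi_density m u) * (ennreal (u / sqrt m) * ?h (sqrt (real m / real s) * r / u)) \<partial>lborel \<partial>lborel)"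
    by (subst lborel_pair.nn_integral_snd[symmetric]) (simp_all add: ennreal_mult chi_density_nonneg)
  also have "\<dots> = (\<integral>\<^sup>+x. ennreal (ratio_density s m x) * ?h x \<partial>lborel)"
    using assms by (intro nn_integral_chi_ratio) auto
  also have "\<dots> = emeasure (density lborel (ratio_density s m)) A"
    by (simp add: emeasure_density)
  finally show "emeasure (distr (density M (\<lambda>\<omega>. ennreal (U \<omega> / sqrt m))) borel (\<lambda>\<omega>. sqrt (real m / real s) * R \<omega> / U \<omega>)) A
    = emeasure (density lborel (ratio_density s m)) A" .
qed simp

section \<open>Integrability and signed integrands\<close>

text \<open>Multiplying the chi density by u raises the power by one, so the mean is a quotient of
  two normalising constants, with m + 1 and m degrees of freedom; in particular it is finite and
  positive.\<close>

lemma (in prob_space)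
  assumes "m > 0" and U: "distributed M lborel U (chi_density m)"
  shows integrable_chi: "integrable M U" and expectation_chi_pos: "0 < (\<integral>\<omega>. U \<omega> \<partial>M)"
proof -
  define D where "D N = 2 powr (real N / 2 - 1) * Gamma (real N / 2)" for N
  have D: "D N > 0" if "N > 0" for N
    using that unfolding D_def by (intro mult_pos_pos Gamma_real_pos) auto
  have "(\<integral>\<^sup>+u. ennreal (chi_density m u * u) \<partial>lborel)
    = (\<integral>\<^sup>+u. ennreal (1 / D m) * ennreal (indicator {0..} u * u ^ (Suc m - 1) * exp (- 1 * u\<^sup>2 / 2)) \<partial>lborel)"
  proof (rule nn_integral_cong)
    fix u :: real
    have "chi_density m u * u = 1 / D m * (indicator {0..} u * u ^ (Suc m - 1) * exp (- 1 * u\<^sup>2 / 2))"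
      using assms(1) by (cases m) (simp_all add: chi_density_def D_def)
    moreover have "0 \<le> 1 / D m" using D[OF assms(1)] by simp
    ultimately show "ennreal (chi_density m u * u)
      = ennreal (1 / D m) * ennreal (indicator {0..} u * u ^ (Suc m - 1) * exp (- 1 * u\<^sup>2 / 2))"
      by (simp only: ennreal_mult')
  qed
  also have "\<dots> = ennreal (1 / D m) * ennreal (D (Suc m) / 1 powr (real (Suc m) / 2))"
    unfolding D_def by (subst nn_integral_cmult) (simp_all only: nn_integral_power_gaussian[OF zero_less_Suc zero_less_one], measurable)
  also have "\<dots> = ennreal (D (Suc m) / D m)"
    using D[OF assms(1)] D[of "Suc m"] by (simp add: ennreal_mult'[symmetric])
  finally have nn_int: "(\<integral>\<^sup>+u. ennreal (chi_density m u * u) \<partial>lborel) = ennreal (D (Suc m) / D m)" .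
  have nn: "0 \<le> chi_density m u * u" for u
    by (cases "0 \<le> u") (simp add: chi_density_nonneg, simp add: chi_density_def)
  have "has_bochner_integral lborel (\<lambda>u. chi_density m u * u) (D (Suc m) / D m)"
    using D[OF assms(1)] D[of "Suc m"]
    by (intro has_bochner_integral_nn_integral) (simp_all add: nn nn_int)
  then have *: "integrable lborel (\<lambda>u. chi_density m u * u)" "(\<integral>u. chi_density m u * u \<partial>lborel) = D (Suc m) / D m"
    by (auto simp: has_bochner_integral_iff)
  show "integrable M U"
    using distributed_integrable[OF U, of "\<lambda>u. u"] * by (simp add: chi_density_nonneg)
  have "(\<integral>\<omega>. U \<omega> \<partial>M) = D (Suc m) / D m"
    using distributed_integral[OF U, of "\<lambda>u. u"] * by (simp add: chi_density_nonneg)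
  then show "0 < (\<integral>\<omega>. U \<omega> \<partial>M)" using D[OF assms(1)] D[of "Suc m"] by simp
qed

lemma (in prob_space)
  fixes R U h :: "_ \<Rightarrow> real"
  assumes "s > 0" "m > 0"
    and R: "distributed M lborel R (chi_density s)" and U: "distributed M lborel U (chi_density m)"
    and indep: "indep_var borel R borel U" and U_nonneg: "\<And>\<omega>. 0 \<le> U \<omega>"
    and [measurable]: "h \<in> borel_measurable borel"
  shows integral_weighted_chi_ratio:
      "(\<integral>\<omega>. U \<omega> / sqrt m * h (sqrt (real m / real s) * R \<omega> / U \<omega>) \<partial>M) = (\<integral>x. ratio_density s m x * h x \<partial>lborel)"
    and integrable_weighted_chi_ratio:
      "integrable M (\<lambda>\<omega>. U \<omega> / sqrt m * h (sqrt (real m / real s) * R \<omega> / U \<omega>)) \<longleftrightarrow> integrable lborel (\<lambda>x. ratio_density s m x * h x)"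
proof -
  have [measurable]: "R \<in> borel_measurable M" "U \<in> borel_measurable M"
    using R U by (auto simp: distributed_def)
  let ?T = "\<lambda>\<omega>. sqrt (real m / real s) * R \<omega> / U \<omega>"
  let ?D = "density M (\<lambda>\<omega>. ennreal (U \<omega> / sqrt m))"
  have *: "distr ?D borel ?T = density lborel (ratio_density s m)"
    by (rule distr_weighted_chi_ratio[OF assms(1,2) R U indep])
  have "(\<integral>\<omega>. U \<omega> / sqrt m * h (?T \<omega>) \<partial>M) = (\<integral>\<omega>. h (?T \<omega>) \<partial>?D)"
    using U_nonneg by (subst integral_density) auto
  also have "\<dots> = (\<integral>x. h x \<partial>distr ?D borel ?T)"
    by (rule integral_distr[symmetric]) auto
  also have "\<dots> = (\<integral>x. ratio_density s m x * h x \<partial>lborel)"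
    unfolding * using ratio_density_nonneg[OF assms(1,2)] by (subst integral_density) auto
  finally show "(\<integral>\<omega>. U \<omega> / sqrt m * h (?T \<omega>) \<partial>M) = (\<integral>x. ratio_density s m x * h x \<partial>lborel)" .
  have "integrable M (\<lambda>\<omega>. U \<omega> / sqrt m * h (?T \<omega>)) \<longleftrightarrow> integrable ?D (\<lambda>\<omega>. h (?T \<omega>))"
    using U_nonneg by (subst integrable_density) auto
  also have "\<dots> \<longleftrightarrow> integrable (distr ?D borel ?T) h"
    by (rule integrable_distr_eq[symmetric]) auto
  also have "\<dots> \<longleftrightarrow> integrable lborel (\<lambda>x. ratio_density s m x * h x)"
    unfolding * using ratio_density_nonneg[OF assms(1,2)] by (subst integrable_density) auto
  finally show "integrable M (\<lambda>\<omega>. U \<omega> / sqrt m * h (?T \<omega>)) \<longleftrightarrow> integrable lborel (\<lambda>x. ratio_density s m x * h x)" .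
qed

text \<open>Writing d = t + (d - t) separates a constant, which integrates to t times the mass E(W),
  from a bounded remainder that matters on [0, k] only.\<close>

lemma (in prob_space) integral_weighted_chi_ratio_eventually_const:
  fixes R U d :: "_ \<Rightarrow> real"
  assumes "s > 0" "m > 0"
    and R: "distributed M lborel R (chi_density s)" and U: "distributed M lborel U (chi_density m)"
    and indep: "indep_var borel R borel U" and U_nonneg: "\<And>\<omega>. 0 \<le> U \<omega>" and R_nonneg: "\<And>\<omega>. 0 \<le> R \<omega>"
    and d: "continuous_on {0..} d" "\<And>x. x \<ge> k \<Longrightarrow> d x = t" and k: "k > 0"
  shows "(\<integral>\<omega>. U \<omega> / sqrt m * d (sqrt (real m / real s) * R \<omega> / U \<omega>) \<partial>M)
    = t * (\<integral>\<omega>. U \<omega> / sqrt m \<partial>M) + integral {0..k} (\<lambda>x. (d x - t) * ratio_density s m x)"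
proof -
  let ?T = "\<lambda>\<omega>. sqrt (real m / real s) * R \<omega> / U \<omega>"
  let ?\<rho> = "ratio_density s m"
  \<comment> \<open>d is controlled on the nonnegative half-line only; extending it by the constant
    d 0 makes it continuous, hence Borel, on all reals. The ratio is nonnegative (and 0 where U =
    0), so the integrand does not change.\<close>
  define d' where "d' x = d (max 0 x)" for x
  have cont: "continuous_on UNIV d'"
    unfolding d'_def by (rule continuous_on_compose2[OF d(1)]) (auto intro!: continuous_intros)
  then have [measurable]: "d' \<in> borel_measurable borel"
    by (rule borel_measurable_continuous_onI)
  note lem = assms(1,2) R U indep U_nonneg
  have "integrable M (\<lambda>\<omega>. U \<omega> / sqrt m * (1::real))"
    using integrable_chi[OF assms(2) U] by simp
  then have int1: "integrable lborel ?\<rho>"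
    using integrable_weighted_chi_ratio[OF lem, of "\<lambda>_. 1"] by simp
  have "compact ((\<lambda>x. d' x - t) ` {0..k})"
    by (rule compact_continuous_image) (auto intro!: continuous_intros continuous_on_subset[OF cont])
  then obtain B where "\<forall>y\<in>(\<lambda>x. d' x - t) ` {0..k}. norm y \<le> B"
    using compact_imp_bounded bounded_iff by metis
  then have B: "\<bar>d' x - t\<bar> \<le> B" if "x \<in> {0..k}" for x using that by auto
  have "B \<ge> 0" using B[of 0] k by auto
  \<comment> \<open>Below 0 the density vanishes, and beyond k the difference does.\<close>
  have split: "?\<rho> x * (d' x - t) = indicator {0..k} x * ((d x - t) * ?\<rho> x)" for x
    using d(2)[of x] k by (auto simp: d'_def ratio_density_def indicator_def)
  have int2: "integrable lborel (\<lambda>x. ?\<rho> x * (d' x - t))"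
  proof (rule Bochner_Integration.integrable_bound)
    show "integrable lborel (\<lambda>x. B * ?\<rho> x)" using int1 by simp
    have "norm (?\<rho> x * (d' x - t)) \<le> norm (B * ?\<rho> x)" for x
    proof (cases "x \<in> {0..k}")
      case True
      then show ?thesis
        using B[OF True] \<open>B \<ge> 0\<close> ratio_density_nonneg[OF assms(1,2), of x]
        by (simp add: abs_mult mult.commute[of B] mult_left_mono)
    next
      case False
      then show ?thesis unfolding split by simp
    qed
    then show "AE x in lborel. norm (?\<rho> x * (d' x - t)) \<le> norm (B * ?\<rho> x)" by simp
  qed measurable
  have "(\<integral>\<omega>. U \<omega> / sqrt m * d (?T \<omega>) \<partial>M) = (\<integral>\<omega>. U \<omega> / sqrt m * d' (?T \<omega>) \<partial>M)"
    using U_nonneg R_nonneg by (simp add: d'_def)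
  also have "\<dots> = (\<integral>x. ?\<rho> x * d' x \<partial>lborel)"
    by (rule integral_weighted_chi_ratio[OF lem]) measurable
  also have "\<dots> = (\<integral>x. t * ?\<rho> x + ?\<rho> x * (d' x - t) \<partial>lborel)"
    by (simp add: algebra_simps)
  also have "\<dots> = t * (\<integral>x. ?\<rho> x \<partial>lborel) + (\<integral>x. ?\<rho> x * (d' x - t) \<partial>lborel)"
    using int1 int2 by (subst Bochner_Integration.integral_add) auto
  \<comment> \<open>The transfer formula with h = 1 recovers the total mass.\<close>
  also have "(\<integral>x. ?\<rho> x \<partial>lborel) = (\<integral>\<omega>. U \<omega> / sqrt m \<partial>M)"
    using integral_weighted_chi_ratio[OF lem, of "\<lambda>_. 1"] by simp
  also have "(\<integral>x. ?\<rho> x * (d' x - t) \<partial>lborel) = (LBINT x:{0..k}. (d x - t) * ?\<rho> x)"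
    unfolding split by (simp add: set_lebesgue_integral_def)
  also have "\<dots> = integral {0..k} (\<lambda>x. (d x - t) * ?\<rho> x)"
    by (rule set_borel_integral_eq_integral) (use int2 in \<open>simp add: set_integrable_def split\<close>)
  finally show ?thesis .
qed

section \<open>Scaled expected length\<close>

lemma lse_add:
  fixes X :: "real^'p^'n"
  assumes "rank X = CARD('p)"
  shows "lse X (X *v b + e) = b + matrix_inv (transpose X ** X) *v (transpose X *v e)"
proof -
  have "inj ((*v) X)" using assms by (simp add: full_rank_injective)
  note inv = matrix_inv_inverse(2)[OF invertible_gram[OF this]]
  have "lse X (X *v b + e) = (matrix_inv (transpose X ** X) ** (transpose X ** X)) *v b
     + matrix_inv (transpose X ** X) *v (transpose X *v e)"
    by (simp only: lse_def matrix_vector_right_distrib matrix_vector_mul_assoc matrix_mul_assoc)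
  then show ?thesis by (simp only: inv matrix_vector_mul_lid)
qed

text \<open>With b = (X^T X)^{-1} a one has a = X^T X b, so the form equals |X b|^2, and X b = 0
  would give a = 0.\<close>

lemma inner_matrix_inv_gram_pos:
  fixes X :: "real^'p^'n"
  assumes "rank X = CARD('p)" "a \<noteq> 0"
  shows "0 < a \<bullet> (matrix_inv (transpose X ** X) *v a)"
proof -
  have inj: "inj ((*v) X)" using assms by (simp add: full_rank_injective)
  define b where "b = matrix_inv (transpose X ** X) *v a"
  have a: "a = transpose X *v (X *v b)"
    unfolding b_def by (simp only: matrix_vector_mul_assoc matrix_inv_inverse[OF invertible_gram[OF inj]] matrix_vector_mul_lid matrix_mul_assoc)
  then have "X *v b \<noteq> 0" using assms(2) by auto
  have "a \<bullet> b = (X *v b) \<bullet> (X *v b)"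
    by (subst (1) a, subst inner_commute) (simp only: inner_transpose_matrix[symmetric] inner_commute)
  then show ?thesis using \<open>X *v b \<noteq> 0\<close> by (simp add: b_def)
qed

text \<open>Both expected lengths carry the factor 2 sqrt(v11) \<sigma>, which cancels; what remains
  is (tm E(W) + correction) / (tm E(W)).\<close>

theorem theorem2:
  fixes M :: "'w measure"
    and X :: "real^'p^'n" and C :: "real^'s^'p"
    and a \<beta> :: "real^'p" and tv :: "real^'s"
    and \<sigma> \<alpha> tm k :: real
    and eps :: "'w \<Rightarrow> real^'n"
    and d :: "real \<Rightarrow> real"
    and Y :: "'w \<Rightarrow> real^'n" and \<tau>hat :: "'w \<Rightarrow> real^'s"
    and \<Sigma>hat \<Theta>hat F W :: "'w \<Rightarrow> real"
  defines "m \<equiv> CARD('n) - CARD('p)"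
    and "s \<equiv> CARD('s)"
    and "\<theta> \<equiv> a \<bullet> \<beta>"
    and "\<tau> \<equiv> transpose C *v \<beta> - tv"
    and "v11 \<equiv> a \<bullet> (matrix_inv (transpose X ** X) *v a)"
    and "V22 \<equiv> transpose C ** matrix_inv (transpose X ** X) ** C"
  assumes "prob_space M"
    and "\<And>\<omega>. W \<omega> = \<Sigma>hat \<omega> / \<sigma>"
    and "\<And>\<omega>. F \<omega> = (\<tau>hat \<omega> \<bullet> (matrix_inv V22 *v \<tau>hat \<omega>) / real s) / (\<Sigma>hat \<omega>)\<^sup>2"
    and "\<And>\<omega>. \<tau>hat \<omega> = transpose C *v lse X (Y \<omega>) - tv"
    and "\<And>\<omega>. \<Theta>hat \<omega> = a \<bullet> lse X (Y \<omega>)"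
    and "\<And>\<omega>. \<Sigma>hat \<omega> = sqrt (sigma_hat_sq X (Y \<omega>))"
    and "\<And>\<omega>. Y \<omega> = X *v \<beta> + eps \<omega>"
    and "CARD('p) < CARD('n)"
    and "rank X = CARD('p)"
    and "\<sigma> > 0"
    and "\<And>i. distributed M lborel (\<lambda>\<omega>. eps \<omega> $ i) (normal_density 0 \<sigma>)"
    and "prob_space.indep_vars M (\<lambda>_. borel) (\<lambda>i \<omega>. eps \<omega> $ i) UNIV"
    and "a \<noteq> 0"
    and "CARD('s) < CARD('p)"
    and "rank C = CARD('s)"
    and "a \<notin> span (columns C)"
    and "\<And>j. (\<integral>\<omega>. (\<tau>hat \<omega> $ j - \<tau> $ j) * (\<Theta>hat \<omega> - \<theta>) \<partial>M) = 0"
    and "0 < \<alpha>" and "\<alpha> < 1"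
    and "(LBINT x=-tm..tm. t_density m x) = 1 - \<alpha>"
    and "k > 0"
    and "continuous_on {0..} d"
    and "\<And>x. x \<ge> 0 \<Longrightarrow> d x > 0"
    and "\<And>x. x \<ge> k \<Longrightarrow> d x = tm"
    and "\<tau> = 0"
  shows "(\<integral>\<omega>. 2 * sqrt v11 * \<Sigma>hat \<omega> * d (sqrt (F \<omega>)) \<partial>M)
           / (\<integral>\<omega>. 2 * tm * sqrt v11 * \<Sigma>hat \<omega> \<partial>M)
         = 1 + (2 powr (3/2) * real s powr (real s / 2) * Gamma ((real s + real m + 1) / 2))
               / (tm * (\<integral>\<omega>. W \<omega> \<partial>M) * Gamma (real m / 2) * Gamma (real s / 2))
             * integral {0..k} (\<lambda>x. (d x - tm) * x ^ (s - 1)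
                 * real m powr (real m / 2) / (real s * x\<^sup>2 + real m) powr ((real s + real m + 1) / 2))"
proof -
  interpret prob_space M by fact
  note W = assms(8) and F = assms(9) and \<tau>hat = assms(10) and \<Sigma>hat = assms(12) and Y = assms(13)
    and pn = assms(14) and rankX = assms(15) and \<sigma> = assms(16) and dist = assms(17) and ind = assms(18)
    and a = assms(19) and rankC = assms(21) and k = assms(27) and cont = assms(28) and d_pos = assms(29)
    and d_const = assms(30) and \<tau>0 = assms(31)
  have "m > 0" using pn by (simp add: m_def)
  have "s > 0" by (simp add: s_def)
  \<comment> \<open>Reconciles the real difference in the variance estimator with the truncated
    difference of naturals that defines m.\<close>
  have real_m: "real CARD('n) - real CARD('p) = real m" using pn by (simp add: m_def of_nat_diff)
  \<comment> \<open>d is positive and takes the value tm at k.\<close>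
  have "tm > 0" using d_pos[of k] d_const[of k] k by simp
  have "v11 > 0" unfolding v11_def by (rule inner_matrix_inv_gram_pos[OF rankX a])
  obtain P Q :: "real^'n \<Rightarrow> real^'n" where
    P: "linear P" "\<And>x y. P x \<bullet> y = x \<bullet> P y" "\<And>x. P (P x) = P x" and dimP: "dim (range P) = CARD('s)" and
    Q: "linear Q" "\<And>x y. Q x \<bullet> y = x \<bullet> Q y" "\<And>x. Q (Q x) = Q x" and dimQ: "dim (range Q) = CARD('n) - CARD('p)" and
    PQ: "\<And>x. P (Q x) = 0" and
    P_eq: "\<And>e. (transpose C *v (matrix_inv (transpose X ** X) *v (transpose X *v e)))
      \<bullet> (matrix_inv V22 *v (transpose C *v (matrix_inv (transpose X ** X) *v (transpose X *v e)))) = (norm (P e))\<^sup>2" and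
    Q_eq: "\<And>b e. X *v b + e - X *v lse X (X *v b + e) = Q e"
  proof (rule regression_quadratic_forms[OF rankX rankC, folded V22_def], goal_cases)
    case (1 P Q)
    show thesis by (rule 1(1)[OF 1(2-)])
  qed
  define Z where "Z i \<omega> = eps \<omega> $ i / \<sigma>" for i \<omega>
  have dist_Z: "distributed M lborel (Z i) std_normal_density" for i
    using dist[of i] normal_standard_normal_convert[OF \<sigma>, of "\<lambda>\<omega>. eps \<omega> $ i" 0] by (simp add: Z_def[abs_def])
  have law_Z: "distr M borel (Z i) = density lborel std_normal_density" for i
  proof -
    have "distr M borel (Z i) = distr M lborel (Z i)" by (rule distr_cong) auto
    also have "\<dots> = density lborel std_normal_density"
      by (rule distributed_distr_eq_density[OF dist_Z])
    finally show ?thesis .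
  qed
  have ind_Z: "indep_vars (\<lambda>_. borel) Z UNIV"
    using indep_vars_compose2[OF ind, of "\<lambda>_ x. x / \<sigma>" "\<lambda>_. borel"] by (simp add: Z_def[abs_def])
  define z where "z \<omega> = (\<chi> i. Z i \<omega>)" for \<omega>
  have eps: "eps \<omega> = \<sigma> *\<^sub>R z \<omega>" for \<omega>
    using \<sigma> by (simp add: z_def Z_def vec_eq_iff)
  define R where "R \<omega> = norm (P (z \<omega>))" for \<omega>
  define U where "U \<omega> = norm (Q (z \<omega>))" for \<omega>
  have dims: "dim (range P) = s" "dim (range Q) = m" by (simp_all add: dimP dimQ s_def m_def)
  note norms = norm_orthogonal_projections[OF ind_Z law_Z P _ Q _ PQ, unfolded dims, OF \<open>s > 0\<close> \<open>m > 0\<close>,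
      folded z_def, folded R_def U_def]
  have \<Sigma>: "\<Sigma>hat \<omega> = \<sigma> * (U \<omega> / sqrt m)" for \<omega>
    using \<sigma> by (simp add: \<Sigma>hat sigma_hat_sq_def Y Q_eq real_m eps linear_cmul[OF Q(1)] U_def real_sqrt_divide)
  have W_eq: "W \<omega> = U \<omega> / sqrt m" for \<omega> using \<sigma> by (simp add: W \<Sigma>)
  \<comment> \<open>Here \<open>\<tau> = 0\<close> enters: C^T \<beta> cancels against
    \<open>tv\<close>, and only the image of the error remains.\<close>
  have \<tau>hat_eq: "\<tau>hat \<omega> = transpose C *v (matrix_inv (transpose X ** X) *v (transpose X *v eps \<omega>))" for \<omega>
    using \<tau>0 by (simp only: \<tau>hat Y lse_add[OF rankX] matrix_vector_right_distrib \<tau>_def) (simp add: algebra_simps)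
  \<comment> \<open>\<sigma> cancels in the ratio. If U = 0, both sides are 0 by the convention for
    division by zero, so the identity holds at every outcome.\<close>
  have F_eq: "sqrt (F \<omega>) = sqrt (real m / real s) * R \<omega> / U \<omega>" for \<omega>
  proof -
    have "F \<omega> = ((\<sigma> * R \<omega>)\<^sup>2 / real s) / (\<sigma> * (U \<omega> / sqrt m))\<^sup>2"
      using \<sigma> by (simp only: F \<tau>hat_eq P_eq \<Sigma>) (simp add: eps linear_cmul[OF P(1)] R_def)
    also have "\<dots> = (sqrt (real m / real s) * R \<omega> / U \<omega>)\<^sup>2"
      using \<sigma> \<open>m > 0\<close> \<open>s > 0\<close> by (simp add: power_mult_distrib power_divide real_sqrt_divide)
    finally show ?thesis by (simp add: R_def U_def)
  qed
  have EU: "(\<integral>\<omega>. U \<omega> / sqrt m \<partial>M) > 0"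
    using expectation_chi_pos[OF \<open>m > 0\<close> norms(2)] \<open>m > 0\<close> by simp
  let ?I = "integral {0..k} (\<lambda>x. (d x - tm) * ratio_density s m x)"
  have main: "(\<integral>\<omega>. U \<omega> / sqrt m * d (sqrt (F \<omega>)) \<partial>M) = tm * (\<integral>\<omega>. U \<omega> / sqrt m \<partial>M) + ?I"
    unfolding F_eq by (rule integral_weighted_chi_ratio_eventually_const[OF \<open>s > 0\<close> \<open>m > 0\<close> norms _ _ cont d_const k])
      (auto simp: U_def R_def)
  let ?c = "2 powr (3/2) * real s powr (real s / 2) * Gamma ((real s + real m + 1) / 2) / (Gamma (real m / 2) * Gamma (real s / 2))"
  let ?J = "integral {0..k} (\<lambda>x. (d x - tm) * x ^ (s - 1)
                 * real m powr (real m / 2) / (real s * x\<^sup>2 + real m) powr ((real s + real m + 1) / 2))"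
  have "?I = integral {0..k} (\<lambda>x. ?c * ((d x - tm) * x ^ (s - 1)
                 * real m powr (real m / 2) / (real s * x\<^sup>2 + real m) powr ((real s + real m + 1) / 2)))"
    \<comment> \<open>On [0, k] the indicator in \<open>ratio_density\<close> is 1, so the constant
      \<open>?c\<close> splits off.\<close>
    by (intro Henstock_Kurzweil_Integration.integral_cong) (simp add: ratio_density_def)
  then have I: "?I = ?c * ?J" by (simp only: integral_mult_right)
  have "(\<integral>\<omega>. 2 * sqrt v11 * \<Sigma>hat \<omega> * d (sqrt (F \<omega>)) \<partial>M)
      = (\<integral>\<omega>. 2 * sqrt v11 * \<sigma> * (U \<omega> / sqrt m * d (sqrt (F \<omega>))) \<partial>M)"
    by (intro Bochner_Integration.integral_cong refl) (simp add: \<Sigma>)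
  then have num: "(\<integral>\<omega>. 2 * sqrt v11 * \<Sigma>hat \<omega> * d (sqrt (F \<omega>)) \<partial>M)
      = 2 * sqrt v11 * \<sigma> * (tm * (\<integral>\<omega>. U \<omega> / sqrt m \<partial>M) + ?I)"
    by (simp only: integral_mult_right_zero main)
  have "(\<integral>\<omega>. 2 * tm * sqrt v11 * \<Sigma>hat \<omega> \<partial>M) = (\<integral>\<omega>. 2 * sqrt v11 * \<sigma> * (tm * (U \<omega> / sqrt m)) \<partial>M)"
    by (intro Bochner_Integration.integral_cong refl) (simp add: \<Sigma>)
  then have den: "(\<integral>\<omega>. 2 * tm * sqrt v11 * \<Sigma>hat \<omega> \<partial>M) = 2 * sqrt v11 * \<sigma> * (tm * (\<integral>\<omega>. U \<omega> / sqrt m \<partial>M))"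
    by (simp only: integral_mult_right_zero)
  have "(\<integral>\<omega>. 2 * sqrt v11 * \<Sigma>hat \<omega> * d (sqrt (F \<omega>)) \<partial>M) / (\<integral>\<omega>. 2 * tm * sqrt v11 * \<Sigma>hat \<omega> \<partial>M)
    = (tm * (\<integral>\<omega>. W \<omega> \<partial>M) + ?c * ?J) / (tm * (\<integral>\<omega>. W \<omega> \<partial>M))"
    unfolding num den I W_eq using \<open>v11 > 0\<close> \<sigma> by simp
  also have "\<dots> = 1 + ?c * ?J / (tm * (\<integral>\<omega>. W \<omega> \<partial>M))"
    using EU \<open>tm > 0\<close> unfolding W_eq[symmetric] by (subst add_divide_distrib) simp
  finally show ?thesis by (simp add: mult_ac)
qed

end
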